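(* There exists a non-Archimedean real closed field of transcendence degree two (over $\mathbb{Q}$) which is rigid, i.e. whose only field automorphism is the identity.
   Context: A real closed field is non-Archimedean if it contains an element larger than every natural number. A structure is rigid if its automorphism group is trivial. *)

theory Defs
  imports "HOL-Algebra.QuotRing"
begin

text \<open>Fields are HOL-Algebra structures. In a real closed field the (unique) field
ordering is given by: x \<le> y iff y - x is a square.\<close>

definition rcf_le :: "('a, 'b) ring_scheme \<Rightarrow> 'a \<Rightarrow> 'a \<Rightarrow> bool" where
  "rcf_le R x y \<longleftrightarrow> (\<exists>z \<in> carrier R. y \<ominus>\<^bsub>R\<^esub> x = z \<otimes>\<^bsub>R\<^esub> z)"

definition rcf_less :: "('a, 'b) ring_scheme \<Rightarrow> 'a \<Rightarrow> 'a \<Rightarrow> bool" where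
  "rcf_less R x y \<longleftrightarrow> rcf_le R x y \<and> x \<noteq> y"

definition formally_real :: "('a, 'b) ring_scheme \<Rightarrow> bool" where
  "formally_real R \<longleftrightarrow>
     (\<forall>(n::nat) a. a \<in> {..<n} \<rightarrow> carrier R \<longrightarrow>
        finsum R (\<lambda>i. a i \<otimes>\<^bsub>R\<^esub> a i) {..<n} \<noteq> \<ominus>\<^bsub>R\<^esub> \<one>\<^bsub>R\<^esub>)"

definition real_closed_field :: "('a, 'b) ring_scheme \<Rightarrow> bool" where
  "real_closed_field R \<longleftrightarrow> field R \<and> formally_real R \<and>
     (\<forall>x \<in> carrier R. (\<exists>y \<in> carrier R. x = y \<otimes>\<^bsub>R\<^esub> y) \<or>
                        (\<exists>y \<in> carrier R. \<ominus>\<^bsub>R\<^esub> x = y \<otimes>\<^bsub>R\<^esub> y)) \<and>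
     (\<forall>(n::nat) a. odd n \<longrightarrow> a \<in> {..n} \<rightarrow> carrier R \<longrightarrow> a n \<noteq> \<zero>\<^bsub>R\<^esub> \<longrightarrow>
        (\<exists>x \<in> carrier R. finsum R (\<lambda>i. a i \<otimes>\<^bsub>R\<^esub> x [^]\<^bsub>R\<^esub> i) {..n} = \<zero>\<^bsub>R\<^esub>))"

definition non_archimedean :: "('a, 'b) ring_scheme \<Rightarrow> bool" where
  "non_archimedean R \<longleftrightarrow>
     (\<exists>x \<in> carrier R. \<forall>n::nat. rcf_less R (add_pow R n \<one>\<^bsub>R\<^esub>) x)"

definition eval_int_poly2 ::
  "('a, 'b) ring_scheme \<Rightarrow> (nat \<Rightarrow> nat \<Rightarrow> int) \<Rightarrow> nat \<Rightarrow> 'a \<Rightarrow> 'a \<Rightarrow> 'a" where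
  "eval_int_poly2 R c N t1 t2 =
     finsum R (\<lambda>i. finsum R (\<lambda>j. add_pow R (c i j)
        (t1 [^]\<^bsub>R\<^esub> i \<otimes>\<^bsub>R\<^esub> t2 [^]\<^bsub>R\<^esub> j)) {..<N}) {..<N}"

text \<open>t1, t2 algebraically independent over the prime field Q (integer
coefficients suffice after clearing denominators).\<close>
definition alg_indep2 :: "('a, 'b) ring_scheme \<Rightarrow> 'a \<Rightarrow> 'a \<Rightarrow> bool" where
  "alg_indep2 R t1 t2 \<longleftrightarrow>
     (\<forall>c N. eval_int_poly2 R c N t1 t2 = \<zero>\<^bsub>R\<^esub> \<longrightarrow> (\<forall>i<N. \<forall>j<N. c i j = 0))"

definition algebraic_over2 :: "('a, 'b) ring_scheme \<Rightarrow> 'a \<Rightarrow> 'a \<Rightarrow> 'a \<Rightarrow> bool" where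
  "algebraic_over2 R t1 t2 x \<longleftrightarrow>
     (\<exists>(c :: nat \<Rightarrow> nat \<Rightarrow> nat \<Rightarrow> int) N.
        (\<exists>k<N. eval_int_poly2 R (\<lambda>i j. c i j k) N t1 t2 \<noteq> \<zero>\<^bsub>R\<^esub>) \<and>
        finsum R (\<lambda>k. eval_int_poly2 R (\<lambda>i j. c i j k) N t1 t2 \<otimes>\<^bsub>R\<^esub> x [^]\<^bsub>R\<^esub> k) {..<N}
          = \<zero>\<^bsub>R\<^esub>)"

definition trdeg_two :: "('a, 'b) ring_scheme \<Rightarrow> bool" where
  "trdeg_two R \<longleftrightarrow>
     (\<exists>t1 \<in> carrier R. \<exists>t2 \<in> carrier R. alg_indep2 R t1 t2 \<and>
        (\<forall>x \<in> carrier R. algebraic_over2 R t1 t2 x))"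

definition rigid_field :: "('a, 'b) ring_scheme \<Rightarrow> bool" where
  "rigid_field R \<longleftrightarrow> (\<forall>h \<in> ring_iso R R. \<forall>x \<in> carrier R. h x = x)"

end

theory Submission
  imports Defs "HOL-Algebra.Finite_Extensions"
    "HOL-Computational_Algebra.Fundamental_Theorem_Algebra" "HOL-Library.Countable_Set"
begin

text \<open>
  The field is the relative algebraic closure, in an ultrapower of the reals, of
  \<open>\<rat>(\<epsilon>, f)\<close>, where \<open>\<epsilon>\<close> is a positive infinitesimal and \<open>f\<close> satisfies
  \<open>\<bar>f - p\<^sub>n(\<epsilon>)\<bar> \<le> \<epsilon> ^ M\<^sub>n\<close> for rational polynomials \<open>p\<^sub>n\<close> that agree to higher and higher order at \<open>0\<close>.
  An automorphism preserves the order, so it is the identity once it fixes \<open>\<epsilon>\<close> and \<open>f\<close>, and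
  it sends \<open>(\<epsilon>, f)\<close> to a pair \<open>(u, w)\<close> with \<open>\<bar>w - p\<^sub>n(u)\<bar> \<le> u ^ M\<^sub>n\<close>; passing to the inverse
  automorphism we may assume \<open>u \<le> \<epsilon>\<close>. Both \<open>u\<close> and \<open>w\<close> are algebraic over \<open>\<rat>(\<epsilon>, f)\<close>, say
  \<open>P(\<epsilon>, f, u) = 0 = Q(\<epsilon>, f, w)\<close>. The sequence is built by diagonalising over all pairs
  \<open>(P, Q)\<close>: at the stage of \<open>(P, Q)\<close> the new polynomial \<open>c\<close> is chosen by interpolation so that
  \<open>P(x, c(x), z)\<close> and \<open>Q(x, c(x), c(z))\<close> generate an ideal containing some nonzero
  \<open>R \<in> \<rat>[x]\<close>. As \<open>f\<close> and \<open>w\<close> are approximated by \<open>c(\<epsilon>)\<close> and \<open>c(u)\<close>, this makes \<open>R(\<epsilon>)\<close>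
  smaller than its order at \<open>0\<close> permits. The same estimate shows that \<open>\<epsilon>\<close> and \<open>f\<close> are
  algebraically independent.
\<close>

section \<open>Evaluation of nested polynomials\<close>

hide_const (open) Polynomials.degree Polynomials.lead_coeff

text \<open>Countability of the nested polynomials lets \<open>from_nat\<close> list all pairs
  \<open>(P, Q)\<close> in the diagonal construction, and makes the relative algebraic closure
  countable.\<close>

instance poly :: ("{countable, zero}") countable
  by (rule countable_classI[of "\<lambda>p. to_nat (coeffs p)"]) (simp add: coeffs_eq_iff)

definition rhom :: "('a::comm_ring_1 \<Rightarrow> 'b::comm_ring_1) \<Rightarrow> bool" where
  "rhom h \<longleftrightarrow> h 0 = 0 \<and> h 1 = 1 \<and> (\<forall>a b. h (a + b) = h a + h b) \<and> (\<forall>a b. h (a * b) = h a * h b)"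

lemma rhomD:
  assumes "rhom h"
  shows "h 0 = 0" "h 1 = 1" "h (a + b) = h a + h b" "h (a * b) = h a * h b"
    "h (- a) = - h a" "h (a - b) = h a - h b"
proof -
  show *: "h 0 = 0" "h 1 = 1" "h (a + b) = h a + h b" "h (a * b) = h a * h b" for a b
    using assms by (auto simp: rhom_def)
  show m: "h (- a) = - h a" for a
    using *(3)[of a "- a"] *(1) by (metis add.right_inverse minus_unique)
  show "h (a - b) = h a - h b"
    using *(3)[of a "- b"] m by simp
qed

lemma rhom_power: "rhom h \<Longrightarrow> h (a ^ n) = h a ^ n"
  by (induction n) (auto simp: rhomD)

lemma rhom_sum: "rhom h \<Longrightarrow> h (sum g A) = (\<Sum>i\<in>A. h (g i))"
  by (induction A rule: infinite_finite_induct) (auto simp: rhomD)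

lemma rhom_of_rat: "rhom (of_rat :: rat \<Rightarrow> 'a::field_char_0)"
  by (simp add: rhom_def of_rat_add of_rat_mult)

text \<open>The coefficient map \<open>h\<close> is a parameter so that evaluation can be iterated:
  \<open>peval h x\<close> is again a homomorphism and can act on the coefficients of the next
  polynomial ring.\<close>

definition peval :: "('a::comm_ring_1 \<Rightarrow> 'b::comm_ring_1) \<Rightarrow> 'b \<Rightarrow> 'a poly \<Rightarrow> 'b" where
  "peval h x p = poly (map_poly h p) x"

lemma peval_0 [simp]: "peval h x 0 = 0"
  by (simp add: peval_def)

lemma peval_pCons: "h 0 = 0 \<Longrightarrow> peval h x (pCons a p) = h a + x * peval h x p"
  by (simp add: peval_def map_poly_pCons)

lemma peval_zero: "h 0 = 0 \<Longrightarrow> peval h 0 p = h (coeff p 0)"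
  by (cases p) (simp add: peval_pCons)

lemma peval_monom: "h 0 = 0 \<Longrightarrow> peval h x (monom a n) = h a * x ^ n"
  by (simp add: peval_def map_poly_monom poly_monom)

lemma peval_lessThan:
  assumes "h 0 = 0" "degree p < n"
  shows "peval h x p = (\<Sum>i<n. h (coeff p i) * x ^ i)"
proof -
  have "poly (map_poly h p) x = (\<Sum>i\<le>degree (map_poly h p). coeff (map_poly h p) i * x ^ i)"
    by (rule poly_altdef)
  also have "\<dots> = (\<Sum>i<n. coeff (map_poly h p) i * x ^ i)"
    using assms(2) map_poly_degree_leq[of h p] by (intro sum.mono_neutral_left) (auto simp: coeff_eq_0)
  finally show ?thesis by (simp add: peval_def coeff_map_poly assms(1))
qed

lemma peval_smult: "rhom h \<Longrightarrow> peval h x (smult a p) = h a * peval h x p"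
  by (induction p) (simp_all add: peval_pCons rhomD algebra_simps)

lemma rhom_peval:
  assumes "rhom h"
  shows "rhom (peval h x)"
proof -
  note [simp] = rhomD[OF assms] peval_pCons
  have add: "peval h x (p + q) = peval h x p + peval h x q" for p q
    by (induction p q rule: poly_induct2) (simp_all add: algebra_simps)
  have smult: "peval h x (smult a q) = h a * peval h x q" for a q
    by (induction q) (simp_all add: algebra_simps)
  have mult: "peval h x (p * q) = peval h x p * peval h x q" for p q
    by (induction p) (simp_all add: add smult algebra_simps)
  have "peval h x 1 = 1"
    by (simp add: one_pCons)
  then show ?thesis
    by (auto simp: rhom_def add mult)
qed

text \<open>Stated relative to a set \<open>S\<close> closed under the operations, because a field
  automorphism of \<open>K\<close> is homomorphic only on \<open>K\<close>, not on the whole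
  type.\<close>

lemma peval_transfer:
  assumes "h 0 = 0" "h' 0 = 0" "0 \<in> S" "\<sigma> 0 = 0"
    and S: "\<And>a b. a \<in> S \<Longrightarrow> b \<in> S \<Longrightarrow> a + b \<in> S \<and> a * b \<in> S \<and> \<sigma> (a + b) = \<sigma> a + \<sigma> b \<and> \<sigma> (a * b) = \<sigma> a * \<sigma> b"
    and h: "\<And>a. h a \<in> S \<and> \<sigma> (h a) = h' a" and x: "x \<in> S"
  shows "peval h x p \<in> S \<and> \<sigma> (peval h x p) = peval h' (\<sigma> x) p"
proof (induction p)
  case (pCons a p)
  then show ?case
    using S[OF x, of "peval h x p"] S[of "h a" "x * peval h x p"] h[of a]
    by (simp add: peval_pCons assms)
qed (auto simp: assms)

text \<open>A \<^typ>\<open>rat poly poly poly\<close> is read as a polynomial in \<open>x, y, z\<close>: \<open>x\<close> is the variable of the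
  innermost and \<open>z\<close> that of the outermost polynomial ring.\<close>

abbreviation ev1 :: "'a::field_char_0 \<Rightarrow> rat poly \<Rightarrow> 'a" where
  "ev1 x \<equiv> peval of_rat x"

abbreviation ev2 :: "'a::field_char_0 \<Rightarrow> 'a \<Rightarrow> rat poly poly \<Rightarrow> 'a" where
  "ev2 x y \<equiv> peval (ev1 x) y"

abbreviation ev3 :: "'a::field_char_0 \<Rightarrow> 'a \<Rightarrow> 'a \<Rightarrow> rat poly poly poly \<Rightarrow> 'a" where
  "ev3 x y z \<equiv> peval (ev2 x y) z"

lemma rhom_ev [simp, intro]:
  "rhom (ev1 x)" "rhom (ev2 x y)" "rhom (ev3 x y z)"
  by (intro rhom_peval rhom_of_rat)+

lemmas ev1_hom = rhomD[OF rhom_ev(1)] rhom_power[OF rhom_ev(1)]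
lemmas ev2_hom = rhomD[OF rhom_ev(2)] rhom_power[OF rhom_ev(2)]
lemmas ev3_hom = rhomD[OF rhom_ev(3)] rhom_power[OF rhom_ev(3)]

lemma ev1_pCons [simp]: "ev1 x (pCons a p) = of_rat a + x * ev1 x p"
  by (simp add: peval_pCons)

lemma ev2_pCons [simp]: "ev2 x y (pCons a p) = ev1 x a + y * ev2 x y p"
  by (simp add: peval_pCons ev1_hom)

lemma ev3_pCons [simp]: "ev3 x y z (pCons a p) = ev2 x y a + z * ev3 x y z p"
  by (simp add: peval_pCons ev2_hom)

lemma ev_smult [simp]:
  "ev1 x (smult a p) = of_rat a * ev1 x p"
  "ev2 x y (smult c T) = ev1 x c * ev2 x y T"
  by (intro peval_smult rhom_of_rat rhom_ev)+

lemma ev1_of_rat: "ev1 (of_rat x) p = of_rat (poly p x)"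
  by (induction p) (simp_all add: of_rat_add of_rat_mult)

text \<open>\<open>P(x, c(x), z)\<close> and \<open>Q(x, c(x), c(z))\<close>, as polynomials in \<open>x, z\<close>.\<close>

definition subst_y :: "'a::comm_ring_1 \<Rightarrow> 'a poly poly \<Rightarrow> 'a poly" where
  "subst_y c P = map_poly (\<lambda>T. poly T c) P"

definition subst_yz :: "rat poly \<Rightarrow> rat poly poly poly \<Rightarrow> rat poly poly" where
  "subst_yz c Q = pcompose (subst_y c Q) (map_poly (\<lambda>a. [:a:]) c)"

lemma ev1_poly: "ev1 x (poly T c) = ev2 x (ev1 x c) T"
  by (induction T) (simp_all add: ev1_hom)

lemma coeff_subst_y: "coeff (subst_y c P) k = poly (coeff P k) c"
  by (simp add: subst_y_def coeff_map_poly)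

lemma subst_y_pCons: "subst_y c (pCons T P) = pCons (poly T c) (subst_y c P)"
  by (simp add: subst_y_def map_poly_pCons)

lemma ev2_subst_y: "ev2 x z (subst_y c P) = ev3 x (ev1 x c) z P"
proof (induction P)
  case 0
  then show ?case by (simp add: subst_y_def)
next
  case (pCons a P)
  then show ?case by (simp add: subst_y_pCons ev1_poly)
qed

lemma ev2_subst_yz: "ev2 x z (subst_yz c Q) = ev3 x (ev1 x c) (ev1 z c) Q"
proof -
  \<comment> \<open>Making each coefficient a constant of the inner ring turns \<open>c\<close> into
    a polynomial in the outer variable, that is, into \<open>c(z)\<close>.\<close>
  have 1: "ev2 x z (map_poly (\<lambda>a. [:a:]) c) = ev1 z c"
    by (induction c) (simp_all add: map_poly_pCons)
  have "ev2 x z (pcompose C q) = ev2 x (ev2 x z q) C" for C q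
    by (induction C) (simp_all add: pcompose_pCons ev2_hom)
  then show ?thesis
    by (simp add: subst_yz_def 1 ev2_subst_y)
qed

section \<open>Elimination and the diagonal sequence\<close>

text \<open>Specialisation of the inner variable at \<open>x\<close>; the outer variable survives as
  \<open>[:0, 1:]\<close>.\<close>

definition spec :: "'a::field_char_0 \<Rightarrow> rat poly poly \<Rightarrow> 'a poly" where
  "spec x = peval (\<lambda>a. [:ev1 x a:]) [:0, 1:]"

lemma rhom_spec: "rhom (spec x)"
  unfolding spec_def by (rule rhom_peval) (simp add: rhom_def ev1_hom one_pCons)

lemma spec_pCons: "spec x (pCons a p) = pCons (ev1 x a) (spec x p)"
  by (simp add: spec_def peval_pCons ev1_hom)

lemma coeff_spec: "coeff (spec x p) i = ev1 x (coeff p i)"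
proof (induction p arbitrary: i)
  case 0
  then show ?case by (simp add: rhomD[OF rhom_spec])
next
  case (pCons a p)
  then show ?case by (cases i) (simp_all add: spec_pCons)
qed

lemma poly_spec: "poly (spec x p) z = ev2 x z p"
  by (induction p) (simp_all add: spec_pCons rhomD[OF rhom_spec])

lemma spec_smult: "spec x (smult a p) = smult (ev1 x a) (spec x p)"
  by (rule poly_eqI) (simp add: coeff_spec ev1_hom)

lemma spec_eq_0:
  assumes "spec (of_rat r :: 'a::field_char_0) q = 0"
  obtains q' where "q = smult [:-r, 1:] q'"
proof -
  have "[:-r, 1:] dvd coeff q i" for i
  proof -
    have "ev1 (of_rat r :: 'a) (coeff q i) = 0"
      using assms by (simp flip: coeff_spec)
    then show ?thesis
      by (simp add: ev1_of_rat poly_eq_0_iff_dvd)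
  qed
  then have "[:[:-r, 1:]:] dvd q"
    by (simp add: const_poly_dvd_iff)
  then obtain q' where "q = [:[:-r, 1:]:] * q'" ..
  then show ?thesis
    using that by simp
qed

text \<open>Factors X - r are pulled out as long as all coefficients vanish at \<open>r\<close>. The
  process stops because each extraction lowers by one the degree of the leading coefficient, a
  polynomial in the inner variable.\<close>

lemma spec_primitive:
  fixes q :: "rat poly poly"
  assumes "q \<noteq> 0"
  obtains k q' where "q = smult ([:-r, 1:] ^ k) q'" "spec (of_rat r :: 'a::field_char_0) q' \<noteq> 0"
  using assms
proof (induction "degree (lead_coeff q)" arbitrary: q thesis rule: less_induct)
  case less
  show ?case
  proof (cases "spec (of_rat r :: 'a) q = 0")
    case False
    then show ?thesis using less.prems(1)[of 0 q] by simp
  next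
    case True
    then obtain q1 where q1: "q = smult [:-r, 1:] q1" by (rule spec_eq_0)
    then have nz: "q1 \<noteq> 0" using less.prems by auto
    have "lead_coeff q = [:-r, 1:] * lead_coeff q1"
      by (simp add: q1 lead_coeff_smult del: mult_pCons_left)
    then have "degree (lead_coeff q) = Suc (degree (lead_coeff q1))"
      using nz by (simp add: degree_mult_eq del: mult_pCons_left)
    then obtain k q' where "q1 = smult ([:-r, 1:] ^ k) q'" "spec (of_rat r :: 'a) q' \<noteq> 0"
      using less.hyps[of q1] nz by (metis lessI)
    then show ?thesis
      using less.prems(1)[of "Suc k" q'] q1 by simp
  qed
qed

text \<open>A Gauss lemma localised at \<open>r\<close>: if X - r divides \<open>a\<close>, then
  \<open>g * q\<close> specialises to 0. Specialised polynomials form an integral domain and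
  \<open>g\<close> survives, so X - r divides \<open>q\<close> and cancels on both sides.\<close>

lemma spec_cancel:
  fixes a :: "rat poly"
  assumes "smult a p = g * q" "a \<noteq> 0" "spec (of_rat r :: 'a::field_char_0) g \<noteq> 0"
  shows "\<exists>a' q'. poly a' r \<noteq> 0 \<and> smult a' p = g * q'"
  using assms
proof (induction "degree a" arbitrary: a q rule: less_induct)
  case less
  show ?case
  proof (cases "poly a r = 0")
    case False
    then show ?thesis using less.prems by blast
  next
    case True
    then obtain a1 where a1: "a = [:-r, 1:] * a1"
      by (auto simp: poly_eq_0_iff_dvd)
    have "spec (of_rat r :: 'a) (g * q) = 0"
      using True less.prems(1)[symmetric] by (simp add: spec_smult ev1_of_rat)
    then have "spec (of_rat r :: 'a) q = 0"
      using less.prems(3) by (simp add: rhomD[OF rhom_spec])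
    then obtain q1 where q1: "q = smult [:-r, 1:] q1" by (rule spec_eq_0)
    have "smult [:-r, 1:] (smult a1 p) = smult [:-r, 1:] (g * q1)"
      using less.prems(1) unfolding a1 q1 by (simp only: smult_smult mult_smult_right)
    then have "smult a1 p = g * q1"
      by (metis (no_types) pCons_eq_0_iff smult_cancel zero_neq_one)
    moreover have "a1 \<noteq> 0" using less.prems a1 by auto
    moreover have "degree a1 < degree a"
      using \<open>a1 \<noteq> 0\<close> by (simp add: a1 degree_mult_eq del: mult_pCons_left)
    ultimately show ?thesis
      using less by blast
  qed
qed

text \<open>An element of least degree of the ideal of \<open>A\<close> and \<open>B\<close> divides both up to factors from
  \<open>\<rat>[x]\<close>. These factors can be made nonzero at \<open>x = r\<close>, so a nonconstant such element would produce a
  common root over \<open>x = r\<close>.\<close>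
lemma elimination:
  fixes A B :: "rat poly poly" and r :: rat
  assumes lc: "poly (lead_coeff A) r \<noteq> 0"
    and no_root: "\<And>z::complex. \<not> (ev2 (of_rat r) z A = 0 \<and> ev2 (of_rat r) z B = 0)"
  shows "\<exists>\<alpha> \<beta> R. R \<noteq> 0 \<and> \<alpha> * A + \<beta> * B = [:R:]"
proof -
  let ?I = "\<lambda>g. \<exists>\<alpha> \<beta>. g = \<alpha> * A + \<beta> * B"
  let ?S = "spec (of_rat r :: complex)"
  have "A \<noteq> 0" using lc by auto
  have "?I A" by (rule exI[of _ 1], rule exI[of _ 0]) simp
  have "?I B" by (rule exI[of _ 0], rule exI[of _ 1]) simp
  obtain g where g: "?I g" "g \<noteq> 0" and gmin: "\<And>g'. ?I g' \<Longrightarrow> g' \<noteq> 0 \<Longrightarrow> degree g \<le> degree g'"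
    using ex_has_least_nat[of "\<lambda>g. ?I g \<and> g \<noteq> 0" A degree] \<open>?I A\<close> \<open>A \<noteq> 0\<close> by blast
  have div: "\<exists>a q. a \<noteq> 0 \<and> smult a p = g * q" if p: "?I p" for p
  proof -
    \<comment> \<open>The coefficients lie in a polynomial ring, so division by \<open>g\<close>
      needs a power of its leading coefficient. The remainder stays in the ideal and has smaller
      degree, hence vanishes.\<close>
    obtain q s where qs: "pseudo_divmod p g = (q, s)" by fastforce
    define a where "a = lead_coeff g ^ (Suc (degree p) - degree g)"
    have a: "smult a p = g * q + s" "s = 0 \<or> degree s < degree g"
      using pseudo_divmod[OF g(2) qs] by (simp_all add: a_def)
    obtain \<alpha> \<beta> \<alpha>' \<beta>' where "g = \<alpha> * A + \<beta> * B" "p = \<alpha>' * A + \<beta>' * B"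
      using g(1) p by metis
    then have "s = (smult a \<alpha>' - q * \<alpha>) * A + (smult a \<beta>' - q * \<beta>) * B"
      using a(1) by (simp add: algebra_simps smult_add_right)
    then have "s = 0" using gmin[of s] a(2) by fastforce
    moreover have "a \<noteq> 0" using g by (simp add: a_def)
    ultimately show ?thesis using a by auto
  qed
  obtain k g1 where g1: "g = smult ([:-r, 1:] ^ k) g1" "?S g1 \<noteq> 0"
    using spec_primitive[OF g(2)] by metis
  have div1: "\<exists>a q. poly a r \<noteq> 0 \<and> smult a p = g1 * q" if p: "?I p" for p
  proof -
    obtain a q where "a \<noteq> 0" "smult a p = g1 * smult ([:-r, 1:] ^ k) q"
      using div[OF p] g1 by auto
    then show ?thesis using spec_cancel g1(2) by blast
  qed
  have root: "ev2 (of_rat r) z p = 0" if p: "?I p" and z: "poly (?S g1) z = 0" for p and z :: complex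
  proof -
    obtain a q where a: "poly a r \<noteq> 0" "smult a p = g1 * q" using div1[OF p] by blast
    have "poly (?S (smult a p)) z = 0"
      using z by (simp add: a(2) rhomD[OF rhom_spec])
    then show ?thesis using a(1) by (simp add: spec_smult ev1_of_rat poly_spec)
  qed
  \<comment> \<open>The leading coefficient of \<open>g1\<close> divides that of
    \<open>smult a A\<close>, which is nonzero at \<open>r\<close>. So specialisation does not lower
    the degree of \<open>g1\<close>.\<close>
  obtain a q where a: "poly a r \<noteq> 0" "smult a A = g1 * q" using div1[OF \<open>?I A\<close>] by blast
  have "lead_coeff (smult a A) = lead_coeff g1 * lead_coeff q"
    unfolding a(2) by (rule lead_coeff_mult)
  then have "a * lead_coeff A = lead_coeff g1 * lead_coeff q" by (metis lead_coeff_smult)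
  then have "poly (lead_coeff g1) r \<noteq> 0"
    using a(1) lc by (metis mult_eq_0_iff poly_mult)
  then have "coeff (?S g1) (degree g1) \<noteq> 0"
    by (simp add: coeff_spec ev1_of_rat)
  then have "degree g1 \<le> degree (?S g1)" by (rule le_degree)
  moreover have "degree (?S g1) = 0"
  proof (rule ccontr)
    \<comment> \<open>Over the complex numbers a nonconstant specialisation has a root, and this
      root is common to \<open>A\<close> and \<open>B\<close>.\<close>
    assume "degree (?S g1) \<noteq> 0"
    then have "\<not> constant (poly (?S g1))" by (simp add: constant_degree)
    then obtain z where "poly (?S g1) z = 0"
      using fundamental_theorem_of_algebra by blast
    then show False using root[OF \<open>?I A\<close>] root[OF \<open>?I B\<close>] no_root by blast
  qed
  ultimately have "degree g = 0" using g1 by simp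
  then obtain R where R: "g = [:R:]" by (rule degree_eq_zeroE)
  obtain \<alpha> \<beta> where "g = \<alpha> * A + \<beta> * B" using g by blast
  then show ?thesis
    using R g(2) by (intro exI[of _ \<alpha>] exI[of _ \<beta>] exI[of _ R]) auto
qed

section \<open>Interpolation of a generic curve\<close>

lemma exists_nonvanishing_point:
  fixes T :: "rat poly poly"
  assumes "T \<noteq> 0"
  obtains x y where "poly (poly T [:y:]) x \<noteq> 0"
proof -
  have inj: "inj (\<lambda>y::rat. [:y:])" by (auto simp: inj_def)
  have "infinite (range (\<lambda>y::rat. [:y:]))"
    using finite_imageD[OF _ inj] infinite_UNIV_char_0 by blast
  moreover have "finite {c. poly T c = 0}" by (rule poly_roots_finite) fact
  \<comment> \<open>Over the integral domain of inner polynomials, \<open>T\<close> has finitely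
    many roots, so some constant \<open>[:y:]\<close> is not one of them; then \<open>x\<close>
    avoids the roots of a nonzero polynomial.\<close>
  ultimately obtain y where "poly T [:y:] \<noteq> 0"
    using finite_subset by (metis (mono_tags, lifting) image_subsetI mem_Collect_eq)
  moreover from this obtain x where "poly (poly T [:y:]) x \<noteq> 0"
    using poly_all_0_iff_0 by blast
  ultimately show ?thesis using that by blast
qed

text \<open>Neither \<open>z = 0\<close> nor \<open>z = x\<close> is a component of \<open>P(x, y, z) = 0\<close>.\<close>
definition admissible :: "rat poly poly poly \<Rightarrow> rat poly poly poly \<Rightarrow> bool" where
  "admissible P Q \<longleftrightarrow> coeff P 0 \<noteq> 0 \<and> poly P [:[:0, 1:]:] \<noteq> 0 \<and> Q \<noteq> 0"

text \<open>A generic rational point \<open>(x, y)\<close> is interpolated by \<open>c\<close>; since no root of \<open>P(x, y, \<cdot>)\<close> is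
  \<open>0\<close> or \<open>x\<close>, the value of \<open>c\<close> at each of these roots can still be moved off the roots of
  \<open>Q(x, y, \<cdot>)\<close>.\<close>
lemma exists_generic_curve:
  fixes p :: "rat poly"
  assumes "admissible P Q"
  shows "\<exists>c. [:0, 1:] ^ N dvd c - p \<and>
    (\<exists>\<alpha> \<beta> R. R \<noteq> 0 \<and> \<alpha> * subst_y c P + \<beta> * subst_yz c Q = [:R:])"
proof -
  have P: "coeff P 0 \<noteq> 0" "poly P [:[:0, 1:]:] \<noteq> 0" "Q \<noteq> 0" "P \<noteq> 0"
    using assms by (auto simp: admissible_def)
  \<comment> \<open>One product collects all genericity conditions at the point: \<open>x\<close>
    nonzero, both leading coefficients nonzero, and neither 0 nor \<open>x\<close> a root of
    \<open>P\<close> in its last variable.\<close>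
  define T where "T = [:[:0, 1:]:] * lead_coeff P * coeff P 0 * poly P [:[:0, 1:]:] * lead_coeff Q"
  have "T \<noteq> 0" using P by (simp add: T_def)
  then obtain x y where xy: "poly (poly T [:y:]) x \<noteq> 0"
    by (rule exists_nonvanishing_point)
  define xc yc where "xc = (of_rat x :: complex)" and "yc = (of_rat y :: complex)"
  have ev2_XY: "ev2 xc yc S = of_rat (poly (poly S [:y:]) x)" for S
  proof -
    have "ev1 xc [:y:] = yc" by (simp add: yc_def)
    then have "ev2 xc yc S = ev1 xc (poly S [:y:])" by (simp add: ev1_poly)
    then show ?thesis by (simp add: xc_def ev1_of_rat)
  qed
  have lc: "ev2 xc yc (lead_coeff P) \<noteq> 0" "ev2 xc yc (lead_coeff Q) \<noteq> 0"
    and P0: "ev2 xc yc (coeff P 0) \<noteq> 0" and PX: "ev2 xc yc (poly P [:[:0, 1:]:]) \<noteq> 0" and x: "x \<noteq> 0"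
    using xy by (auto simp: ev2_XY T_def)
  have "ev2 xc yc (poly P [:[:0, 1:]:]) = ev3 xc yc (ev2 xc yc [:[:0, 1:]:]) P"
    by (induction P) (simp_all add: ev2_hom)
  also have "ev2 xc yc [:[:0, 1:]:] = xc" by simp
  finally have PXX: "ev3 xc yc xc P \<noteq> 0" using PX by simp
  have P00: "ev3 xc yc 0 P \<noteq> 0" using P0 by (simp add: peval_zero ev2_hom)
  have fin: "finite {z. ev3 xc yc z S = 0}" if "ev2 xc yc (lead_coeff S) \<noteq> 0" for S
  proof -
    have "coeff (map_poly (ev2 xc yc) S) (degree S) \<noteq> 0"
      using that by (simp add: coeff_map_poly ev2_hom)
    then have "map_poly (ev2 xc yc) S \<noteq> 0" by auto
    then show ?thesis unfolding peval_def[of "ev2 xc yc"] by (rule poly_roots_finite)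
  qed
  define Z where "Z = {z. ev3 xc yc z P = 0}"
  define W where "W = {w. ev3 xc yc w Q = 0}"
  have "finite Z" "finite W" using fin lc by (auto simp: Z_def W_def)
  have Z: "z \<noteq> 0" "z \<noteq> xc" if "z \<in> Z" for z using that P00 PXX by (auto simp: Z_def)
  \<comment> \<open>With this \<open>r\<close> the curve takes the value \<open>y\<close> at
    \<open>x\<close>. The factor X - x leaves that value unchanged for every \<open>s\<close>, and
    the power X^N preserves the low-order terms of \<open>p\<close>.\<close>
  define r where "r = (y - poly p x) / x ^ N"
  define c where "c s = p + [:0, 1:] ^ N * ([:r:] + [:-x, 1:] * [:s:])" for s
  define a where "a z = ev1 z p + z ^ N * of_rat r" for z :: complex
  define b where "b z = z ^ N * (z - xc)" for z :: complex
  have ev1_c: "ev1 z (c s) = a z + b z * of_rat s" for z s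
    by (simp add: c_def a_def b_def xc_def ev1_hom of_rat_minus of_rat_diff of_rat_mult algebra_simps)
  \<comment> \<open>For a root \<open>z\<close> in \<open>Z\<close> the factor \<open>b z\<close> is
    nonzero, so each pair \<open>(z, w)\<close> rules out exactly one value of \<open>s\<close>.
    Finitely many values are ruled out, and there are infinitely many rationals.\<close>
  have "finite ((\<lambda>(z, w). (w - a z) / b z) ` (Z \<times> W))"
    using \<open>finite Z\<close> \<open>finite W\<close> by blast
  moreover have "infinite (range (of_rat :: rat \<Rightarrow> complex))"
    using finite_imageD[of of_rat UNIV] infinite_UNIV_char_0 by (auto simp: inj_on_def)
  ultimately have "\<not> range of_rat \<subseteq> (\<lambda>(z, w). (w - a z) / b z) ` (Z \<times> W)"
    using finite_subset by metis
  then obtain s where s: "of_rat s \<notin> (\<lambda>(z, w). (w - a z) / b z) ` (Z \<times> W)"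
    by (meson image_subsetI)
  have avoid: "ev1 z (c s) \<notin> W" if "z \<in> Z" for z
  proof
    assume W: "ev1 z (c s) \<in> W"
    have "b z \<noteq> 0" using Z[OF that] by (simp add: b_def)
    then have "of_rat s = (ev1 z (c s) - a z) / b z" by (simp add: ev1_c)
    moreover have "(z, ev1 z (c s)) \<in> Z \<times> W" using that W by simp
    ultimately have "of_rat s \<in> (\<lambda>(z, w). (w - a z) / b z) ` (Z \<times> W)"
      by (intro image_eqI[of _ _ "(z, ev1 z (c s))"]) simp_all
    then show False using s by contradiction
  qed
  have cx: "poly (c s) x = y" using x by (simp add: c_def r_def field_simps)
  then have cX: "ev1 xc (c s) = yc" by (simp add: xc_def yc_def ev1_of_rat)
  have coeff_x: "of_rat (poly (coeff (subst_y (c s) P) k) x) = ev2 xc yc (coeff P k)" for k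
    by (simp add: coeff_subst_y ev1_poly cX flip: ev1_of_rat xc_def)
  \<comment> \<open>Since the leading coefficient of \<open>P\<close> is nonzero at the chosen
    point, substitution keeps the degree, which yields the leading coefficient hypothesis of
    \<open>elimination\<close>.\<close>
  have "degree (subst_y (c s) P) = degree P"
  proof (rule antisym)
    show "degree (subst_y (c s) P) \<le> degree P"
      unfolding subst_y_def by (rule map_poly_degree_leq)
    have "coeff (subst_y (c s) P) (degree P) \<noteq> 0"
      using coeff_x[of "degree P"] lc by force
    then show "degree P \<le> degree (subst_y (c s) P)" by (rule le_degree)
  qed
  then have "poly (lead_coeff (subst_y (c s) P)) x \<noteq> 0"
    using coeff_x[of "degree P"] lc by force
  moreover have "\<not> (ev2 (of_rat x) z (subst_y (c s) P) = 0 \<and> ev2 (of_rat x) z (subst_yz (c s) Q) = 0)"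
    for z :: complex
    using avoid[of z] by (auto simp: ev2_subst_y ev2_subst_yz cX Z_def W_def simp flip: xc_def)
  ultimately have "\<exists>\<alpha> \<beta> R. R \<noteq> 0 \<and> \<alpha> * subst_y (c s) P + \<beta> * subst_yz (c s) Q = [:R:]"
    by (rule elimination)
  moreover have "[:0, 1:] ^ N dvd c s - p" unfolding c_def by (simp only: add_diff_cancel_left' dvd_triv_left)
  ultimately show ?thesis by blast
qed

text \<open>The inequality puts errors of size \<open>\<epsilon> ^ M\<close> strictly below
  \<open>\<epsilon> ^ Suc (order 0 R)\<close>, a lower bound for \<open>R(\<epsilon>)\<close>, even
  after multiplication by natural constants.\<close>

definition excludes :: "rat poly \<Rightarrow> nat \<Rightarrow> rat poly poly poly \<Rightarrow> rat poly poly poly \<Rightarrow> bool" where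
  "excludes c M P Q \<longleftrightarrow> (\<exists>\<alpha> \<beta> R. R \<noteq> 0 \<and> \<alpha> * subst_y c P + \<beta> * subst_yz c Q = [:R:] \<and> order 0 R + 2 < M)"

text \<open>Stage \<open>n\<close> treats the pair with code \<open>n\<close>. Later stages change
  only terms of degree above \<open>M n\<close>, so the exclusion achieved there persists for the
  limit. The \<open>Suc\<close> supplies a spare factor that later absorbs constants.\<close>

lemma exists_diagonal_sequence:
  obtains p :: "nat \<Rightarrow> rat poly" and M :: "nat \<Rightarrow> nat" where
    "p 0 = 0" "strict_mono M" "\<And>m n. m \<le> n \<Longrightarrow> [:0, 1:] ^ Suc (M m) dvd p n - p m"
    "\<And>P Q. admissible P Q \<Longrightarrow> \<exists>n. excludes (p n) (M n) P Q"
proof -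
  define task :: "nat \<Rightarrow> rat poly poly poly \<times> rat poly poly poly" where "task = from_nat"
  define step where "step n s t \<longleftrightarrow> snd s < snd t \<and> [:0, 1:] ^ Suc (snd s) dvd fst t - fst s \<and>
    (case task n of (P, Q) \<Rightarrow> admissible P Q \<longrightarrow> excludes (fst t) (snd t) P Q)"
    for n and s t :: "rat poly \<times> nat"
  have "\<exists>t. step n s t" for n s
  proof -
    obtain P Q where PQ: "task n = (P, Q)" by fastforce
    show ?thesis
    proof (cases "admissible P Q")
      case True
      then obtain c \<alpha> \<beta> R where c: "[:0, 1:] ^ Suc (snd s) dvd c - fst s" "R \<noteq> 0"
        "\<alpha> * subst_y c P + \<beta> * subst_yz c Q = [:R:]"
        using exists_generic_curve by blast
      \<comment> \<open>The elimination yields \<open>R\<close> only after \<open>c\<close> is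
        chosen, so the new precision is fixed last, large enough for the order of
        \<open>R\<close>.\<close>
      have excl: "excludes c (snd s + order 0 R + 3) P Q"
        unfolding excludes_def
        by (rule exI[of _ \<alpha>], rule exI[of _ \<beta>], rule exI[of _ R]) (simp add: c)
      have "step n s (c, snd s + order 0 R + 3)"
        using c excl by (simp add: step_def PQ del: power_Suc)
      then show ?thesis ..
    next
      case False
      then have "step n s (fst s, Suc (snd s))" by (simp add: step_def PQ)
      then show ?thesis ..
    qed
  qed
  \<comment> \<open>The predicate given to dependent choice constrains only stage 0 and serves to
    fix the starting value.\<close>
  then have "\<exists>s. (s 0 = (0, 0) \<or> False) \<and> (\<forall>n. step n (s n) (s (Suc n)))"
    using dependent_nat_choice[of "\<lambda>n s. n = 0 \<longrightarrow> s = (0, 0)" step] by auto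
  then obtain s where s0: "s 0 = (0, 0)" and s: "\<And>n. step n (s n) (s (Suc n))" by blast
  have mono: "strict_mono (\<lambda>n. snd (s n))"
    unfolding strict_mono_Suc_iff using s by (simp add: step_def)
  show ?thesis
  proof (rule that[of "\<lambda>n. fst (s n)" "\<lambda>n. snd (s n)"])
    show "fst (s 0) = 0" using s0 by simp
    show "strict_mono (\<lambda>n. snd (s n))" by (fact mono)
    show "[:0, 1:] ^ Suc (snd (s m)) dvd fst (s n) - fst (s m)" if "m \<le> n" for m n
      using that
    proof (induction n rule: dec_induct)
      case (step n)
      have "[:0, 1:] ^ Suc (snd (s m)) dvd [:0, 1 :: rat:] ^ Suc (snd (s n))"
        using strict_mono_mono[OF mono] step(1) by (intro le_imp_power_dvd) (auto simp: mono_def)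
      also have "\<dots> dvd fst (s (Suc n)) - fst (s n)"
        using s[of n] by (simp add: step_def)
      finally have "[:0, 1:] ^ Suc (snd (s m)) dvd fst (s (Suc n)) - fst (s n) + (fst (s n) - fst (s m))"
        using step(3) by (rule dvd_add)
      then show ?case by simp
    qed simp
    show "\<exists>n. excludes (fst (s n)) (snd (s n)) P Q" if "admissible P Q" for P Q
    proof -
      have "task (to_nat (P, Q)) = (P, Q)" by (simp add: task_def)
      then show ?thesis using s[of "to_nat (P, Q)"] that by (auto simp: step_def)
    qed
  qed
qed

section \<open>Infinitesimal estimates and automorphisms\<close>

text \<open>The bound is a natural number because an infinitesimal absorbs exactly such constants.
  It is uniform over a family \<open>H\<close>, so the lemma can be applied again to the evaluations
  it bounds.\<close>

lemma peval_bound: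
  fixes H :: "('a::comm_ring_1 \<Rightarrow> 'b::linordered_field) set"
  assumes H0: "\<And>h. h \<in> H \<Longrightarrow> h 0 = 0" and H: "\<And>a. \<exists>C::nat. \<forall>h\<in>H. \<bar>h a\<bar> \<le> of_nat C"
  shows "\<exists>C::nat. \<forall>h\<in>H. \<forall>x. \<bar>x\<bar> \<le> 1 \<longrightarrow> \<bar>peval h x p\<bar> \<le> of_nat C"
proof (induction p)
  case 0
  then show ?case by simp
next
  case (pCons a p)
  obtain C D :: nat where C: "\<And>h. h \<in> H \<Longrightarrow> \<bar>h a\<bar> \<le> of_nat C"
    and D: "\<And>h x. h \<in> H \<Longrightarrow> \<bar>x\<bar> \<le> 1 \<Longrightarrow> \<bar>peval h x p\<bar> \<le> of_nat D"
    using H[of a] pCons.IH by blast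
  have "\<bar>peval h x (pCons a p)\<bar> \<le> of_nat (C + D)" if h: "h \<in> H" and x: "\<bar>x\<bar> \<le> 1" for h x
  proof -
    have "\<bar>x * peval h x p\<bar> \<le> 1 * of_nat D"
      unfolding abs_mult using x D[OF h x] by (intro mult_mono) auto
    then show ?thesis
      using C[OF h] abs_triangle_ineq[of "h a" "x * peval h x p"] by (simp add: peval_pCons H0 h)
  qed
  then show ?case by blast
qed

text \<open>In a triple \<open>(h, h', d)\<close>, \<open>d\<close> measures how far apart the two
  coefficient maps are. Keeping it as a parameter makes the estimate iterable over nested polynomial
  rings.\<close>

lemma peval_lipschitz:
  fixes H :: "(('a::comm_ring_1 \<Rightarrow> 'b::linordered_field) \<times> ('a \<Rightarrow> 'b) \<times> 'b) set"
  assumes H0: "\<And>h h' d. (h, h', d) \<in> H \<Longrightarrow> h 0 = 0 \<and> h' 0 = 0 \<and> 0 \<le> d"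
    and H: "\<And>a. \<exists>C::nat. \<forall>(h, h', d)\<in>H. \<bar>h' a\<bar> \<le> of_nat C \<and> \<bar>h a - h' a\<bar> \<le> of_nat C * d"
  shows "\<exists>C::nat. \<forall>(h, h', d)\<in>H. \<forall>x x'. \<bar>x\<bar> \<le> 1 \<longrightarrow> \<bar>x'\<bar> \<le> 1 \<longrightarrow>
    \<bar>peval h x p - peval h' x' p\<bar> \<le> of_nat C * (d + \<bar>x - x'\<bar>)"
proof (induction p)
  case 0
  then show ?case by (auto intro!: exI[of _ 0])
next
  case (pCons a p)
  obtain C :: nat where C: "\<And>h h' d. (h, h', d) \<in> H \<Longrightarrow> \<bar>h a - h' a\<bar> \<le> of_nat C * d"
    using H[of a] by blast
  obtain D :: nat where D: "\<And>h h' d x x'. (h, h', d) \<in> H \<Longrightarrow> \<bar>x\<bar> \<le> 1 \<Longrightarrow> \<bar>x'\<bar> \<le> 1 \<Longrightarrow>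
      \<bar>peval h x p - peval h' x' p\<bar> \<le> of_nat D * (d + \<bar>x - x'\<bar>)"
    using pCons.IH by blast
  have "\<exists>E::nat. \<forall>h'\<in>{h'. \<exists>h d. (h, h', d) \<in> H}. \<forall>x'. \<bar>x'\<bar> \<le> 1 \<longrightarrow> \<bar>peval h' x' p\<bar> \<le> of_nat E"
    by (rule peval_bound) (use H0 H in \<open>blast+\<close>)
  then obtain E :: nat where E: "\<And>h h' d x'. (h, h', d) \<in> H \<Longrightarrow> \<bar>x'\<bar> \<le> 1 \<Longrightarrow> \<bar>peval h' x' p\<bar> \<le> of_nat E"
    by blast
  have "\<bar>peval h x (pCons a p) - peval h' x' (pCons a p)\<bar> \<le> of_nat (C + D + E) * (d + \<bar>x - x'\<bar>)"
    if h: "(h, h', d) \<in> H" and x: "\<bar>x\<bar> \<le> 1" "\<bar>x'\<bar> \<le> 1" for h h' d x x'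
  proof -
    have d: "0 \<le> d" "h 0 = 0" "h' 0 = 0" using H0[OF h] by auto
    have "\<bar>x * (peval h x p - peval h' x' p)\<bar> \<le> 1 * (of_nat D * (d + \<bar>x - x'\<bar>))"
      unfolding abs_mult using x D[OF h x] d by (intro mult_mono) auto
    moreover have "\<bar>(x - x') * peval h' x' p\<bar> \<le> \<bar>x - x'\<bar> * of_nat E"
      unfolding abs_mult using E[OF h x(2)] by (intro mult_mono) auto
    moreover have "\<bar>x - x'\<bar> * of_nat E \<le> (d + \<bar>x - x'\<bar>) * of_nat E"
      using d by (intro mult_right_mono) auto
    moreover have "of_nat C * d \<le> of_nat C * (d + \<bar>x - x'\<bar>)"
      by (intro mult_left_mono) auto
    \<comment> \<open>The difference is telescoped by changing the constant coefficient, the tail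
      and the argument one at a time.\<close>
    moreover have "peval h x (pCons a p) - peval h' x' (pCons a p) =
       (h a - h' a) + x * (peval h x p - peval h' x' p) + (x - x') * peval h' x' p"
      by (simp add: peval_pCons d algebra_simps)
    moreover have "\<bar>(h a - h' a) + x * (peval h x p - peval h' x' p) + (x - x') * peval h' x' p\<bar>
       \<le> \<bar>h a - h' a\<bar> + \<bar>x * (peval h x p - peval h' x' p)\<bar> + \<bar>(x - x') * peval h' x' p\<bar>"
      by (meson abs_triangle_ineq add_right_mono order_trans)
    ultimately have "\<bar>peval h x (pCons a p) - peval h' x' (pCons a p)\<bar>
      \<le> of_nat C * (d + \<bar>x - x'\<bar>) + of_nat D * (d + \<bar>x - x'\<bar>) + (d + \<bar>x - x'\<bar>) * of_nat E"
      using C[OF h] by simp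
    also have "\<dots> = of_nat (C + D + E) * (d + \<bar>x - x'\<bar>)"
      by (simp add: algebra_simps)
    finally show ?thesis .
  qed
  then show ?case by blast
qed

lemma of_rat_bound: "\<exists>C::nat. \<bar>of_rat a :: 'a::linordered_field\<bar> \<le> of_nat C"
proof -
  obtain C :: nat where "\<bar>a\<bar> \<le> of_nat C" using real_arch_simple by blast
  then have "(of_rat \<bar>a\<bar> :: 'a) \<le> of_rat (of_nat C)" by (simp only: of_rat_less_eq)
  then show ?thesis by (auto simp: abs_if of_rat_minus split: if_splits)
qed

lemma ev_bound:
  "\<exists>C::nat. \<forall>x::'a::linordered_field. \<bar>x\<bar> \<le> 1 \<longrightarrow> \<bar>ev1 x R\<bar> \<le> of_nat C"
  "\<exists>C::nat. \<forall>x y::'a::linordered_field. \<bar>x\<bar> \<le> 1 \<longrightarrow> \<bar>y\<bar> \<le> 1 \<longrightarrow> \<bar>ev2 x y T\<bar> \<le> of_nat C"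
  "\<exists>C::nat. \<forall>x y z::'a::linordered_field. \<bar>x\<bar> \<le> 1 \<longrightarrow> \<bar>y\<bar> \<le> 1 \<longrightarrow> \<bar>z\<bar> \<le> 1 \<longrightarrow>
    \<bar>ev3 x y z P\<bar> \<le> of_nat C"
proof -
  have 1: "\<exists>C::nat. \<forall>h\<in>{of_rat}. \<forall>x::'a. \<bar>x\<bar> \<le> 1 \<longrightarrow> \<bar>peval h x R\<bar> \<le> of_nat C" for R
    by (rule peval_bound) (use of_rat_bound in auto)
  have 2: "\<exists>C::nat. \<forall>h\<in>{ev1 x | x::'a. \<bar>x\<bar> \<le> 1}. \<forall>y. \<bar>y\<bar> \<le> 1 \<longrightarrow> \<bar>peval h y T\<bar> \<le> of_nat C" for T
  proof (rule peval_bound)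
    fix a
    show "\<exists>C::nat. \<forall>h\<in>{ev1 x | x::'a. \<bar>x\<bar> \<le> 1}. \<bar>h a\<bar> \<le> of_nat C"
      using 1[of a] by blast
  qed (auto simp: ev1_hom)
  have 3: "\<exists>C::nat. \<forall>h\<in>{ev2 x y | x y::'a. \<bar>x\<bar> \<le> 1 \<and> \<bar>y\<bar> \<le> 1}. \<forall>z. \<bar>z\<bar> \<le> 1 \<longrightarrow> \<bar>peval h z P\<bar> \<le> of_nat C"
  proof (rule peval_bound)
    fix a
    show "\<exists>C::nat. \<forall>h\<in>{ev2 x y | x y::'a. \<bar>x\<bar> \<le> 1 \<and> \<bar>y\<bar> \<le> 1}. \<bar>h a\<bar> \<le> of_nat C"
      using 2[of a] by blast
  qed (auto simp: ev2_hom)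
  show "\<exists>C::nat. \<forall>x::'a::linordered_field. \<bar>x\<bar> \<le> 1 \<longrightarrow> \<bar>ev1 x R\<bar> \<le> of_nat C"
    using 1 by blast
  show "\<exists>C::nat. \<forall>x y::'a::linordered_field. \<bar>x\<bar> \<le> 1 \<longrightarrow> \<bar>y\<bar> \<le> 1 \<longrightarrow> \<bar>ev2 x y T\<bar> \<le> of_nat C"
    using 2 by blast
  show "\<exists>C::nat. \<forall>x y z::'a::linordered_field. \<bar>x\<bar> \<le> 1 \<longrightarrow> \<bar>y\<bar> \<le> 1 \<longrightarrow> \<bar>z\<bar> \<le> 1 \<longrightarrow> \<bar>ev3 x y z P\<bar> \<le> of_nat C"
    using 3 by blast
qed

lemma ev3_lipschitz:
  "\<exists>C::nat. \<forall>x y y' z z'::'a::linordered_field.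
    \<bar>x\<bar> \<le> 1 \<longrightarrow> \<bar>y\<bar> \<le> 1 \<longrightarrow> \<bar>y'\<bar> \<le> 1 \<longrightarrow> \<bar>z\<bar> \<le> 1 \<longrightarrow> \<bar>z'\<bar> \<le> 1 \<longrightarrow>
    \<bar>ev3 x y z P - ev3 x y' z' P\<bar> \<le> of_nat C * (\<bar>y - y'\<bar> + \<bar>z - z'\<bar>)"
proof -
  \<comment> \<open>The first variable is not perturbed, so the distance starts at 0; at the next
    level it is the change in the second variable.\<close>
  let ?H = "{(ev1 x, ev1 x, 0) | x::'a. \<bar>x\<bar> \<le> 1}"
  let ?H' = "{(ev2 x y, ev2 x y', \<bar>y - y'\<bar>) | x y y'::'a. \<bar>x\<bar> \<le> 1 \<and> \<bar>y\<bar> \<le> 1 \<and> \<bar>y'\<bar> \<le> 1}"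
  have 2: "\<exists>C::nat. \<forall>(h, h', d)\<in>?H. \<forall>y y'. \<bar>y\<bar> \<le> 1 \<longrightarrow> \<bar>y'\<bar> \<le> 1 \<longrightarrow>
    \<bar>peval h y T - peval h' y' T\<bar> \<le> of_nat C * (d + \<bar>y - y'\<bar>)" for T
  proof (rule peval_lipschitz)
    fix a
    show "\<exists>C::nat. \<forall>(h, h', d)\<in>?H. \<bar>h' a\<bar> \<le> of_nat C \<and> \<bar>h a - h' a\<bar> \<le> of_nat C * d"
      using ev_bound(1)[where ?'a = 'a, of a] by auto
  qed (auto simp: ev1_hom)
  have "\<exists>C::nat. \<forall>(h, h', d)\<in>?H'.
    \<forall>z z'. \<bar>z\<bar> \<le> 1 \<longrightarrow> \<bar>z'\<bar> \<le> 1 \<longrightarrow> \<bar>peval h z P - peval h' z' P\<bar> \<le> of_nat C * (d + \<bar>z - z'\<bar>)"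
  proof (rule peval_lipschitz)
    fix a
    obtain C :: nat where C': "\<forall>(h, h', d)\<in>?H. \<forall>y y'. \<bar>y\<bar> \<le> 1 \<longrightarrow> \<bar>y'\<bar> \<le> 1 \<longrightarrow>
       \<bar>peval h y a - peval h' y' a\<bar> \<le> of_nat C * (d + \<bar>y - y'\<bar>)"
      using 2[of a] by blast
    have C: "\<bar>ev2 x y a - ev2 x y' a\<bar> \<le> of_nat C * \<bar>y - y'\<bar>"
      if "\<bar>x\<bar> \<le> 1" "\<bar>y\<bar> \<le> 1" "\<bar>y'\<bar> \<le> 1" for x y y' :: 'a
      using bspec[OF C', of "(ev1 x, ev1 x, 0)"] that by auto
    obtain D :: nat where D: "\<And>x y::'a. \<bar>x\<bar> \<le> 1 \<Longrightarrow> \<bar>y\<bar> \<le> 1 \<Longrightarrow> \<bar>ev2 x y a\<bar> \<le> of_nat D"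
      using ev_bound(2)[where ?'a = 'a, of a] by blast
    have "\<bar>ev2 x y' a\<bar> \<le> of_nat (C + D) \<and> \<bar>ev2 x y a - ev2 x y' a\<bar> \<le> of_nat (C + D) * \<bar>y - y'\<bar>"
      if "\<bar>x\<bar> \<le> 1" "\<bar>y\<bar> \<le> 1" "\<bar>y'\<bar> \<le> 1" for x y y' :: 'a
    proof -
      have "(of_nat C :: 'a) * \<bar>y - y'\<bar> \<le> of_nat (C + D) * \<bar>y - y'\<bar>"
        by (intro mult_right_mono) auto
      moreover have "(of_nat D :: 'a) \<le> of_nat (C + D)" by simp
      ultimately show ?thesis using C[OF that] D[OF that(1,3)] by (meson order_trans)
    qed
    then show "\<exists>C::nat. \<forall>(h, h', d)\<in>?H'.
       \<bar>h' a\<bar> \<le> of_nat C \<and> \<bar>h a - h' a\<bar> \<le> of_nat C * d"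
      by (intro exI[of _ "C + D"]) auto
  qed (auto simp: ev2_hom)
  then obtain C :: nat where C: "\<forall>(h, h', d)\<in>?H'. \<forall>z z'. \<bar>z\<bar> \<le> 1 \<longrightarrow> \<bar>z'\<bar> \<le> 1 \<longrightarrow>
     \<bar>peval h z P - peval h' z' P\<bar> \<le> of_nat C * (d + \<bar>z - z'\<bar>)"
    by blast
  show ?thesis
  proof (intro exI[of _ C] allI impI)
    fix x y y' z z' :: 'a
    assume "\<bar>x\<bar> \<le> 1" "\<bar>y\<bar> \<le> 1" "\<bar>y'\<bar> \<le> 1" "\<bar>z\<bar> \<le> 1" "\<bar>z'\<bar> \<le> 1"
    then show "\<bar>ev3 x y z P - ev3 x y' z' P\<bar> \<le> of_nat C * (\<bar>y - y'\<bar> + \<bar>z - z'\<bar>)"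
      using bspec[OF C, of "(ev2 x y, ev2 x y', \<bar>y - y'\<bar>)"] by blast
  qed
qed

text \<open>The polynomials \<open>p n\<close> converge to a formal power series, and
  \<open>f\<close> acts as its value at the infinitesimal \<open>\<epsilon>\<close>.\<close>

locale generic_pair =
  fixes p :: "nat \<Rightarrow> rat poly" and M :: "nat \<Rightarrow> nat" and \<epsilon> f :: "'a::linordered_field"
  assumes p_0: "p 0 = 0" and M_mono: "strict_mono M"
    and p_dvd: "\<And>m n. m \<le> n \<Longrightarrow> [:0, 1:] ^ Suc (M m) dvd p n - p m"
    and p_excludes: "\<And>P Q. admissible P Q \<Longrightarrow> \<exists>n. excludes (p n) (M n) P Q"
    and eps_pos: "0 < \<epsilon>" and eps_infinitesimal: "\<And>n::nat. of_nat n * \<epsilon> < 1"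
    and f_approx: "\<And>n. \<bar>f - ev1 \<epsilon> (p n)\<bar> \<le> \<epsilon> ^ M n"
begin

lemma eps_le_1: "\<epsilon> \<le> 1"
  using eps_infinitesimal[of 1] by simp

lemma eps_power_mono: "m \<le> n \<Longrightarrow> \<epsilon> ^ n \<le> \<epsilon> ^ m"
  using eps_pos eps_le_1 by (simp add: power_decreasing)

text \<open>One spare factor \<open>\<epsilon>\<close> swallows any natural constant.\<close>

lemma eps_power_absorb:
  assumes "m < n"
  shows "of_nat C * \<epsilon> ^ n < \<epsilon> ^ m"
proof -
  have "of_nat C * \<epsilon> ^ n \<le> of_nat C * \<epsilon> ^ Suc m"
    using assms by (intro mult_left_mono eps_power_mono) auto
  also have "\<dots> = (of_nat C * \<epsilon>) * \<epsilon> ^ m" by simp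
  also have "\<dots> < 1 * \<epsilon> ^ m"
    using eps_infinitesimal eps_pos by (intro mult_strict_right_mono) auto
  finally show ?thesis by simp
qed

lemma M_ge: "n \<le> M n"
  using M_mono by (rule strict_mono_imp_increasing)

text \<open>Every \<open>p n\<close> is divisible by its variable because \<open>p 0 = 0\<close>.
  Its value at \<open>u\<close> is therefore an infinitesimal times a quantity bounded by a natural
  number.\<close>

lemma ev1_p_bound: "\<bar>u\<bar> \<le> \<epsilon> \<Longrightarrow> \<bar>ev1 u (p n)\<bar> \<le> 1"
proof -
  assume u: "\<bar>u\<bar> \<le> \<epsilon>"
  have "[:0, 1:] dvd p n"
    using p_dvd[of 0 n] p_0 by (metis diff_zero dvd_mult_left le0 power_Suc)
  then obtain q where q: "p n = [:0, 1:] * q" ..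
  obtain C :: nat where C: "\<And>x::'a. \<bar>x\<bar> \<le> 1 \<Longrightarrow> \<bar>ev1 x q\<bar> \<le> of_nat C"
    using ev_bound(1) by blast
  have "\<bar>ev1 u (p n)\<bar> = \<bar>ev1 u q\<bar> * \<bar>u\<bar>" by (simp add: q ev1_hom abs_mult)
  also have "\<dots> \<le> of_nat C * \<epsilon>"
    using C[of u] u eps_le_1 by (intro mult_mono) auto
  finally show ?thesis using eps_infinitesimal[of C] by simp
qed

lemma approx_bound:
  assumes "\<bar>w - ev1 u (p 0)\<bar> \<le> \<epsilon> ^ M 0"
  shows "\<bar>w\<bar> \<le> 1"
  using assms eps_power_mono[of 0 "M 0"] by (simp add: p_0)

text \<open>After splitting off the power of X, the cofactor \<open>S\<close> has a nonzero rational
  constant term \<open>s\<close>, and its value at \<open>\<epsilon>\<close> differs from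
  \<open>s\<close> only by an infinitesimal.\<close>

lemma ev1_eps_lower:
  assumes "R \<noteq> 0"
  shows "\<epsilon> ^ Suc (order 0 R) < \<bar>ev1 \<epsilon> R\<bar>"
proof -
  obtain S where S: "R = [:0, 1:] ^ order 0 R * S" "\<not> [:0, 1:] dvd S"
    using order_decomp[OF assms, of 0] by auto
  obtain s S' where S': "S = pCons s S'" by (cases S) auto
  have "s \<noteq> 0" using S(2) unfolding S' by (auto simp: poly_eq_0_iff_dvd[of _ 0, simplified, symmetric])
  obtain C :: nat where C: "\<And>x::'a. \<bar>x\<bar> \<le> 1 \<Longrightarrow> \<bar>ev1 x S'\<bar> \<le> of_nat C"
    using ev_bound(1) by blast
  \<comment> \<open>A natural bound on \<open>1 / s\<close> keeps \<open>s\<close> away from all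
    infinitesimals.\<close>
  obtain m :: nat where m: "\<bar>of_rat (1 / s) :: 'a\<bar> \<le> of_nat m" using of_rat_bound by blast
  have "of_nat m * of_nat (Suc C) * \<epsilon> < 1"
    using eps_infinitesimal[of "m * Suc C"] by (simp only: of_nat_mult)
  have "of_nat (Suc C) * \<epsilon> = \<bar>of_rat s\<bar> * (\<bar>of_rat (1 / s)\<bar> * (of_nat (Suc C) * \<epsilon>))"
    using \<open>s \<noteq> 0\<close> by (simp add: of_rat_divide)
  also have "\<dots> \<le> \<bar>of_rat s\<bar> * (of_nat m * (of_nat (Suc C) * \<epsilon>))"
    using m eps_pos by (intro mult_left_mono mult_right_mono) auto
  also have "\<dots> < \<bar>of_rat s\<bar> * 1"
    using \<open>s \<noteq> 0\<close> \<open>of_nat m * of_nat (Suc C) * \<epsilon> < 1\<close>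
    by (intro mult_strict_left_mono) (simp_all only: mult.assoc zero_less_abs_iff of_rat_eq_0_iff not_False_eq_True)
  finally have s: "of_nat (Suc C) * \<epsilon> < \<bar>of_rat s :: 'a\<bar>" by simp
  have "\<bar>\<epsilon> * ev1 \<epsilon> S'\<bar> \<le> \<epsilon> * of_nat C"
    unfolding abs_mult using eps_pos eps_le_1 C[of \<epsilon>] by (intro mult_mono) auto
  then have "\<epsilon> < \<bar>ev1 \<epsilon> S\<bar>"
    using s abs_triangle_ineq2[of "of_rat s" "- (\<epsilon> * ev1 \<epsilon> S')"] by (simp add: S' algebra_simps)
  then have "\<epsilon> ^ order 0 R * \<epsilon> < \<epsilon> ^ order 0 R * \<bar>ev1 \<epsilon> S\<bar>"
    using eps_pos by (intro mult_strict_left_mono) auto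
  moreover have "ev1 \<epsilon> R = \<epsilon> ^ order 0 R * ev1 \<epsilon> S"
    by (subst S(1)) (simp add: ev1_hom)
  ultimately show ?thesis
    using eps_pos by (simp add: abs_mult mult.commute)
qed

text \<open>Replacing \<open>f\<close> and \<open>w\<close> by values of \<open>c = p n\<close>
  perturbs both polynomials by a constant times \<open>\<epsilon> ^ M n\<close>. Their combination
  equal to \<open>R(\<epsilon>)\<close> is then smaller than \<open>ev1_eps_lower\<close>
  allows.\<close>

lemma exclusion:
  assumes "admissible P Q"
  obtains N where "\<And>u w. \<bar>u\<bar> \<le> \<epsilon> \<Longrightarrow> (\<And>n. \<bar>w - ev1 u (p n)\<bar> \<le> \<epsilon> ^ M n) \<Longrightarrow>
    \<bar>ev3 \<epsilon> f u P\<bar> \<le> \<epsilon> ^ N \<Longrightarrow> \<bar>ev3 \<epsilon> f w Q\<bar> \<le> \<epsilon> ^ N \<Longrightarrow> False"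
proof -
  obtain n where "excludes (p n) (M n) P Q" using p_excludes[OF assms] by blast
  then obtain \<alpha> \<beta> R where R: "R \<noteq> 0" "\<alpha> * subst_y (p n) P + \<beta> * subst_yz (p n) Q = [:R:]"
    "order 0 R + 2 < M n"
    by (auto simp: excludes_def)
  show ?thesis
  proof (rule that[of "M n"])
    fix u w
    assume u: "\<bar>u\<bar> \<le> \<epsilon>" and w: "\<And>n. \<bar>w - ev1 u (p n)\<bar> \<le> \<epsilon> ^ M n"
      and P: "\<bar>ev3 \<epsilon> f u P\<bar> \<le> \<epsilon> ^ M n" and Q: "\<bar>ev3 \<epsilon> f w Q\<bar> \<le> \<epsilon> ^ M n"
    define c e where "c = p n" and "e = \<epsilon> ^ M n"
    have e: "0 \<le> e" using eps_pos by (simp add: e_def)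
    have bounds: "\<bar>\<epsilon>\<bar> \<le> 1" "\<bar>f\<bar> \<le> 1" "\<bar>w\<bar> \<le> 1" "\<bar>u\<bar> \<le> 1" "\<bar>ev1 \<epsilon> c\<bar> \<le> 1" "\<bar>ev1 u c\<bar> \<le> 1"
      using eps_pos eps_le_1 u approx_bound[OF f_approx] approx_bound[OF w] ev1_p_bound[of \<epsilon>] ev1_p_bound[OF u]
      by (auto simp: c_def)
    obtain C1 :: nat where C1: "\<And>x y y' z z'::'a.
        \<bar>x\<bar> \<le> 1 \<Longrightarrow> \<bar>y\<bar> \<le> 1 \<Longrightarrow> \<bar>y'\<bar> \<le> 1 \<Longrightarrow> \<bar>z\<bar> \<le> 1 \<Longrightarrow> \<bar>z'\<bar> \<le> 1 \<Longrightarrow>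
        \<bar>ev3 x y z P - ev3 x y' z' P\<bar> \<le> of_nat C1 * (\<bar>y - y'\<bar> + \<bar>z - z'\<bar>)"
      using ev3_lipschitz[where ?'a = 'a, of P] by blast
    obtain C2 :: nat where C2: "\<And>x y y' z z'::'a.
        \<bar>x\<bar> \<le> 1 \<Longrightarrow> \<bar>y\<bar> \<le> 1 \<Longrightarrow> \<bar>y'\<bar> \<le> 1 \<Longrightarrow> \<bar>z\<bar> \<le> 1 \<Longrightarrow> \<bar>z'\<bar> \<le> 1 \<Longrightarrow>
        \<bar>ev3 x y z Q - ev3 x y' z' Q\<bar> \<le> of_nat C2 * (\<bar>y - y'\<bar> + \<bar>z - z'\<bar>)"
      using ev3_lipschitz[where ?'a = 'a, of Q] by blast
    obtain C3 :: nat where C3: "\<bar>ev2 \<epsilon> u \<alpha>\<bar> \<le> of_nat C3" using ev_bound(2) bounds by metis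
    obtain C4 :: nat where C4: "\<bar>ev2 \<epsilon> u \<beta>\<bar> \<le> of_nat C4" using ev_bound(2) bounds by metis
    have fc: "\<bar>ev1 \<epsilon> c - f\<bar> \<le> e" using f_approx[of n] by (simp add: c_def e_def abs_minus_commute)
    have wc: "\<bar>ev1 u c - w\<bar> \<le> e" using w[of n] by (simp add: c_def e_def abs_minus_commute)
    define A B where "A = ev2 \<epsilon> u (subst_y c P)" and "B = ev2 \<epsilon> u (subst_yz c Q)"
    \<comment> \<open>In \<open>P\<close> only the second argument is replaced; in \<open>Q\<close>
      below both the second and the third are.\<close>
    have "\<bar>A - ev3 \<epsilon> f u P\<bar> \<le> of_nat C1 * (\<bar>ev1 \<epsilon> c - f\<bar> + \<bar>u - u\<bar>)"
      unfolding A_def ev2_subst_y by (rule C1) (use bounds in auto)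
    also have "\<dots> \<le> of_nat C1 * e"
      using fc by (intro mult_left_mono) auto
    finally have A: "\<bar>A\<bar> \<le> of_nat (C1 + 1) * e" using P by (simp add: e_def[symmetric] algebra_simps)
    have "\<bar>B - ev3 \<epsilon> f w Q\<bar> \<le> of_nat C2 * (\<bar>ev1 \<epsilon> c - f\<bar> + \<bar>ev1 u c - w\<bar>)"
      unfolding B_def ev2_subst_yz by (rule C2) (use bounds in auto)
    also have "\<dots> \<le> of_nat C2 * (e + e)"
      using fc wc by (intro mult_left_mono add_mono) auto
    finally have B: "\<bar>B\<bar> \<le> of_nat (C2 + C2 + 1) * e" using Q by (simp add: e_def[symmetric] algebra_simps)
    have "ev1 \<epsilon> R = ev2 \<epsilon> u [:R:]" by simp
    also have "\<dots> = ev2 \<epsilon> u \<alpha> * A + ev2 \<epsilon> u \<beta> * B"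
      unfolding R(2)[symmetric] A_def B_def c_def ev2_hom ..
    finally have "\<bar>ev1 \<epsilon> R\<bar> \<le> \<bar>ev2 \<epsilon> u \<alpha>\<bar> * \<bar>A\<bar> + \<bar>ev2 \<epsilon> u \<beta>\<bar> * \<bar>B\<bar>"
      by (metis abs_mult abs_triangle_ineq)
    also have "\<dots> \<le> of_nat C3 * (of_nat (C1 + 1) * e) + of_nat C4 * (of_nat (C2 + C2 + 1) * e)"
      using A B C3 C4 e by (intro add_mono mult_mono) auto
    also have "\<dots> = of_nat (C3 * (C1 + 1) + C4 * (C2 + C2 + 1)) * e"
      by (simp add: algebra_simps)
    also have "\<dots> < \<epsilon> ^ Suc (order 0 R)"
      unfolding e_def using R(3) by (intro eps_power_absorb) simp
    finally show False using ev1_eps_lower[OF R(1)] by simp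
  qed
qed

text \<open>Quantitative algebraic independence: exclusion is applied to \<open>T\<close> read as a
  polynomial constant in the last variable, at the pair \<open>(\<epsilon>, f)\<close>
  itself.\<close>

lemma ev2_lower:
  assumes "T \<noteq> 0"
  obtains N where "\<epsilon> ^ N < \<bar>ev2 \<epsilon> f T\<bar>"
proof -
  have "admissible [:T:] [:T:]" using assms by (simp add: admissible_def)
  then obtain N where N: "\<And>u w. \<bar>u\<bar> \<le> \<epsilon> \<Longrightarrow> (\<And>n. \<bar>w - ev1 u (p n)\<bar> \<le> \<epsilon> ^ M n) \<Longrightarrow>
    \<bar>ev3 \<epsilon> f u [:T:]\<bar> \<le> \<epsilon> ^ N \<Longrightarrow> \<bar>ev3 \<epsilon> f w [:T:]\<bar> \<le> \<epsilon> ^ N \<Longrightarrow> False"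
    using exclusion by blast
  have "\<not> \<bar>ev2 \<epsilon> f T\<bar> \<le> \<epsilon> ^ N"
    using N[of \<epsilon> f] eps_pos f_approx by auto
  then show ?thesis using that[of N] by (simp add: not_le)
qed

lemma ev2_eq_0_iff: "ev2 \<epsilon> f T = 0 \<longleftrightarrow> T = 0"
  using ev2_lower[of T] eps_pos by (metis abs_zero peval_0 not_less_iff_gr_or_eq zero_less_power)

section \<open>Elements algebraic over the generators\<close>

definition alg :: "'a \<Rightarrow> bool" where
  "alg x \<longleftrightarrow> (\<exists>P. P \<noteq> 0 \<and> ev3 \<epsilon> f x P = 0)"

text \<open>For \<open>P\<close> of least degree, a root \<open>T\<close> with another value than
  \<open>x\<close> would split off a linear factor and leave a smaller annihilating polynomial. The
  choices \<open>T = 0\<close> and \<open>T = [:[:0, 1:]:]\<close> later give admissibility.\<close>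

lemma alg_minimal:
  assumes "alg x"
  obtains P where "P \<noteq> 0" "ev3 \<epsilon> f x P = 0" "\<And>T. ev2 \<epsilon> f T \<noteq> x \<Longrightarrow> poly P T \<noteq> 0"
proof -
  obtain P where P: "P \<noteq> 0" "ev3 \<epsilon> f x P = 0"
    and min: "\<And>P'. P' \<noteq> 0 \<Longrightarrow> ev3 \<epsilon> f x P' = 0 \<Longrightarrow> degree P \<le> degree P'"
    using assms ex_has_least_nat[of "\<lambda>P. P \<noteq> 0 \<and> ev3 \<epsilon> f x P = 0" _ degree] unfolding alg_def by metis
  have "poly P T \<noteq> 0" if T: "ev2 \<epsilon> f T \<noteq> x" for T
  proof
    assume "poly P T = 0"
    then obtain P' where P': "P = [:-T, 1:] * P'" by (auto simp: poly_eq_0_iff_dvd)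
    then have "P' \<noteq> 0" using P(1) by auto
    moreover have "(x - ev2 \<epsilon> f T) * ev3 \<epsilon> f x P' = 0"
      using P(2) unfolding P' ev3_hom by (simp add: ev2_hom algebra_simps)
    then have "ev3 \<epsilon> f x P' = 0" using T by simp
    ultimately have "degree P \<le> degree P'" by (rule min)
    moreover have "degree P = Suc (degree P')"
      using \<open>P' \<noteq> 0\<close> by (simp add: P' degree_mult_eq del: mult_pCons_left)
    ultimately show False by simp
  qed
  then show ?thesis using P that by blast
qed

text \<open>The constant coefficient of a minimal equation for \<open>v\<close> is nonzero and
  equals \<open>v\<close> times a bounded quantity, so the lower bound for it passes to
  \<open>v\<close>.\<close>

lemma alg_lower:
  assumes "alg v" "v \<noteq> 0"
  obtains N where "\<epsilon> ^ N < \<bar>v\<bar>"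
proof (cases "\<bar>v\<bar> \<le> 1")
  case False
  then show ?thesis using that[of 0] by simp
next
  case True
  obtain P where P: "ev3 \<epsilon> f v P = 0" "\<And>T. ev2 \<epsilon> f T \<noteq> v \<Longrightarrow> poly P T \<noteq> 0"
    using alg_minimal[OF assms(1)] by metis
  obtain T P' where T: "P = pCons T P'" by (cases P) auto
  have "T \<noteq> 0" using P(2)[of 0] assms(2) by (simp add: T)
  then obtain N where N: "\<epsilon> ^ N < \<bar>ev2 \<epsilon> f T\<bar>" by (rule ev2_lower)
  have "\<bar>f\<bar> \<le> 1" by (rule approx_bound[OF f_approx])
  then obtain C :: nat where C: "\<bar>ev3 \<epsilon> f v P'\<bar> \<le> of_nat C"
    using ev_bound(3)[where ?'a = 'a, of P'] True eps_pos eps_le_1 by (metis abs_of_pos)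
  have "ev2 \<epsilon> f T = - (ev3 \<epsilon> f v P' * v)"
    using P(1) by (simp add: T eq_neg_iff_add_eq_0 mult.commute)
  then have "\<bar>ev2 \<epsilon> f T\<bar> = \<bar>ev3 \<epsilon> f v P'\<bar> * \<bar>v\<bar>" by (simp add: abs_mult)
  also have "\<dots> \<le> of_nat C * \<bar>v\<bar>" using C by (intro mult_right_mono) auto
  finally have "\<epsilon> ^ N < of_nat C * \<bar>v\<bar>" using N by simp
  then have "of_nat C * \<epsilon> ^ Suc N < of_nat C * \<bar>v\<bar>"
    using eps_power_absorb[of N "Suc N" C] by simp
  then have "\<epsilon> ^ Suc N < \<bar>v\<bar>"
    by (rule mult_left_less_imp_less) simp
  then show ?thesis by (rule that)
qed

end

section \<open>Automorphisms of subfields closed under square roots\<close>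

definition subfield_set :: "'a::field set \<Rightarrow> bool" where
  "subfield_set K \<longleftrightarrow> 1 \<in> K \<and> (\<forall>a\<in>K. \<forall>b\<in>K. a - b \<in> K \<and> a * b \<in> K) \<and> (\<forall>a\<in>K. inverse a \<in> K)"

lemma subfield_setD:
  assumes "subfield_set K"
  shows "0 \<in> K" "1 \<in> K" "a \<in> K \<Longrightarrow> b \<in> K \<Longrightarrow> a + b \<in> K" "a \<in> K \<Longrightarrow> b \<in> K \<Longrightarrow> a - b \<in> K"
    "a \<in> K \<Longrightarrow> b \<in> K \<Longrightarrow> a * b \<in> K" "a \<in> K \<Longrightarrow> inverse a \<in> K" "a \<in> K \<Longrightarrow> - a \<in> K"
proof -
  have *: "1 \<in> K" "\<And>a b. a \<in> K \<Longrightarrow> b \<in> K \<Longrightarrow> a - b \<in> K" "\<And>a b. a \<in> K \<Longrightarrow> b \<in> K \<Longrightarrow> a * b \<in> K"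
    "\<And>a. a \<in> K \<Longrightarrow> inverse a \<in> K"
    using assms by (auto simp: subfield_set_def)
  show 0: "0 \<in> K" using *(2)[OF *(1,1)] by simp
  show m: "a \<in> K \<Longrightarrow> - a \<in> K" for a using *(2)[OF 0, of a] by simp
  show "a \<in> K \<Longrightarrow> b \<in> K \<Longrightarrow> a + b \<in> K" using *(2)[of a "- b"] m by simp
qed (use assms in \<open>auto simp: subfield_set_def\<close>)

lemma subfield_set_of_rat:
  fixes K :: "'a::field_char_0 set"
  assumes "subfield_set K"
  shows "of_rat r \<in> K"
proof -
  note [intro] = subfield_setD[OF assms]
  have nat: "of_nat n \<in> K" for n by (induction n) auto
  have int: "of_int n \<in> K" for n by (cases n rule: int_cases2) (use nat in auto)
  show ?thesis
  proof (cases r)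
    case (Fract a b)
    then have "of_rat r = of_int a * inverse (of_int b :: 'a)"
      by (simp add: of_rat_rat divide_inverse)
    then show ?thesis using int by auto
  qed
qed

text \<open>Square roots make the nonnegative elements of \<open>K\<close> exactly its squares, so
  the algebraic conditions on \<open>\<sigma>\<close> already force it to preserve the
  order.\<close>

locale field_aut =
  fixes K :: "'a::linordered_field set" and \<sigma> :: "'a \<Rightarrow> 'a"
  assumes K: "subfield_set K" and sqrt: "\<And>a. a \<in> K \<Longrightarrow> 0 \<le> a \<Longrightarrow> \<exists>b\<in>K. a = b * b"
    and bij: "bij_betw \<sigma> K K"
    and add: "\<And>a b. a \<in> K \<Longrightarrow> b \<in> K \<Longrightarrow> \<sigma> (a + b) = \<sigma> a + \<sigma> b"
    and mult: "\<And>a b. a \<in> K \<Longrightarrow> b \<in> K \<Longrightarrow> \<sigma> (a * b) = \<sigma> a * \<sigma> b"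
begin

lemmas K_closed = subfield_setD[OF K]

lemma in_K: "a \<in> K \<Longrightarrow> \<sigma> a \<in> K"
  using bij by (auto simp: bij_betw_def)

lemma inj: "a \<in> K \<Longrightarrow> b \<in> K \<Longrightarrow> \<sigma> a = \<sigma> b \<longleftrightarrow> a = b"
  using bij by (auto simp: bij_betw_def inj_on_def)

lemma zero: "\<sigma> 0 = 0"
  using add[of 0 0] K_closed by simp

lemma minus: "a \<in> K \<Longrightarrow> \<sigma> (- a) = - \<sigma> a"
  using add[of a "- a"] K_closed zero by (metis add.right_inverse minus_unique)

lemma diff: "a \<in> K \<Longrightarrow> b \<in> K \<Longrightarrow> \<sigma> (a - b) = \<sigma> a - \<sigma> b"
  using add[of a "- b"] K_closed minus by simp

lemma one: "\<sigma> 1 = 1"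
proof -
  have "\<sigma> 1 * \<sigma> 1 = \<sigma> 1" using mult[of 1 1] K_closed by simp
  moreover have "\<sigma> 1 \<noteq> 0" using inj[of 1 0] zero K_closed by simp
  ultimately show ?thesis by simp
qed

lemma power: "a \<in> K \<Longrightarrow> a ^ n \<in> K \<and> \<sigma> (a ^ n) = \<sigma> a ^ n"
  by (induction n) (auto simp: one mult K_closed)

lemma of_rat: "of_rat r \<in> K \<and> \<sigma> (of_rat r) = of_rat r"
proof -
  have nat: "of_nat n \<in> K \<and> \<sigma> (of_nat n) = of_nat n" for n
    by (induction n) (auto simp: one zero add K_closed)
  have int: "of_int n \<in> K \<and> \<sigma> (of_int n) = of_int n" for n
    by (cases n rule: int_cases2) (use nat in \<open>auto simp: minus K_closed\<close>)
  show ?thesis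
  proof (cases r)
    case (Fract a b)
    then have eq: "of_rat r * of_int b = (of_int a :: 'a)"
      by (simp add: of_rat_rat)
    have r: "of_rat r \<in> K" by (rule subfield_set_of_rat[OF K])
    have "\<sigma> (of_rat r) * of_int b = of_int a"
      using mult[OF r, of "of_int b"] int eq by metis
    then have "\<sigma> (of_rat r) = (of_rat r :: 'a)"
      using eq Fract(2) by (metis mult_cancel_right of_int_eq_0_iff less_irrefl)
    then show ?thesis using r by simp
  qed
qed

lemma nonneg: "a \<in> K \<Longrightarrow> 0 \<le> a \<Longrightarrow> 0 \<le> \<sigma> a"
  using sqrt[of a] mult by fastforce

lemma le: "a \<in> K \<Longrightarrow> b \<in> K \<Longrightarrow> a \<le> b \<Longrightarrow> \<sigma> a \<le> \<sigma> b"
  using nonneg[of "b - a"] diff K_closed by simp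

lemma less: "a \<in> K \<Longrightarrow> b \<in> K \<Longrightarrow> a < b \<Longrightarrow> \<sigma> a < \<sigma> b"
  using le inj by (metis less_le)

lemma abs: "a \<in> K \<Longrightarrow> \<bar>a\<bar> \<in> K \<and> \<sigma> \<bar>a\<bar> = \<bar>\<sigma> a\<bar>"
  using nonneg[of a] nonneg[of "- a"] minus K_closed by (auto simp: abs_if)

lemma ev1: "x \<in> K \<Longrightarrow> ev1 x R \<in> K \<and> \<sigma> (ev1 x R) = ev1 (\<sigma> x) R"
  using peval_transfer[of of_rat of_rat K \<sigma> x R] of_rat add mult zero K_closed by simp

lemma ev2: "x \<in> K \<Longrightarrow> y \<in> K \<Longrightarrow> ev2 x y T \<in> K \<and> \<sigma> (ev2 x y T) = ev2 (\<sigma> x) (\<sigma> y) T"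
  using peval_transfer[of "ev1 x" "ev1 (\<sigma> x)" K \<sigma> y T] ev1 add mult zero K_closed by (simp add: ev1_hom)

lemma ev3: "x \<in> K \<Longrightarrow> y \<in> K \<Longrightarrow> z \<in> K \<Longrightarrow>
    ev3 x y z P \<in> K \<and> \<sigma> (ev3 x y z P) = ev3 (\<sigma> x) (\<sigma> y) (\<sigma> z) P"
  using peval_transfer[of "ev2 x y" "ev2 (\<sigma> x) (\<sigma> y)" K \<sigma> z P] ev2 add mult zero K_closed
  by (simp add: ev2_hom)

lemma inverse_aut: "field_aut K (inv_into K \<sigma>)"
proof
  have inv: "inv_into K \<sigma> (\<sigma> a) = a" if "a \<in> K" for a
    using bij that by (rule bij_betw_inv_into_left)
  have surj: "\<exists>a'\<in>K. a = \<sigma> a'" if "a \<in> K" for a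
    using bij that by (auto simp: bij_betw_def)
  fix a b assume "a \<in> K" "b \<in> K"
  then obtain a' b' where ab: "a' \<in> K" "b' \<in> K" "a = \<sigma> a'" "b = \<sigma> b'"
    using surj by metis
  show "inv_into K \<sigma> (a + b) = inv_into K \<sigma> a + inv_into K \<sigma> b"
    using ab inv add K_closed by metis
  show "inv_into K \<sigma> (a * b) = inv_into K \<sigma> a * inv_into K \<sigma> b"
    using ab inv mult K_closed by metis
qed (use K sqrt bij_betw_inv_into[OF bij] in auto)

end

text \<open>Consider the least moved point \<open>m\<close>. Either \<open>g m\<close> lies below
  it, or its preimage does; that smaller point is fixed, which contradicts strict monotonicity or
  the choice of the preimage.\<close>

lemma strict_mono_on_finite_fixes:
  fixes g :: "'a::linorder \<Rightarrow> 'a"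
  assumes "finite Z" and into: "g ` Z \<subseteq> Z" and mono: "\<And>a b. a \<in> Z \<Longrightarrow> b \<in> Z \<Longrightarrow> a < b \<Longrightarrow> g a < g b"
    and z: "z \<in> Z"
  shows "g z = z"
proof (rule ccontr)
  assume "g z \<noteq> z"
  define S where "S = {z \<in> Z. g z \<noteq> z}"
  define m where "m = Min S"
  have "finite S" "S \<noteq> {}" using assms(1) z \<open>g z \<noteq> z\<close> by (auto simp: S_def)
  then have m: "m \<in> S" and min: "\<And>s. s \<in> S \<Longrightarrow> m \<le> s" by (auto simp: m_def)
  have inj: "inj_on g Z" using mono by (metis inj_onI linorder_neqE less_irrefl)
  then have surj: "g ` Z = Z" using assms(1) into by (simp add: endo_inj_surj)
  have mZ: "m \<in> Z" "g m \<noteq> m" using m by (auto simp: S_def)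
  show False
  proof (cases "g m < m")
    case True
    then have "g m \<notin> S" using min by force
    then have "g (g m) = g m" using into mZ by (auto simp: S_def)
    then show False using mono[of "g m" m] True into mZ by auto
  next
    case False
    then have "m < g m" using mZ by simp
    have "m \<in> g ` Z" using surj mZ by simp
    then obtain y where y: "y \<in> Z" "g y = m" by (rule imageE) auto
    have "y < m"
      using mono[of m y] \<open>m < g m\<close> y mZ by (metis less_asym linorder_neqE)
    then have "y \<notin> S" using min by force
    then show False using y \<open>y < m\<close> by (simp add: S_def)
  qed
qed

context generic_pair
begin

lemma aut_fixes_generators:
  assumes "field_aut K \<sigma>" and alg: "\<And>x. x \<in> K \<Longrightarrow> alg x" and gens: "\<epsilon> \<in> K" "f \<in> K"
    and eps_le: "\<sigma> \<epsilon> \<le> \<epsilon>"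
  shows "\<sigma> \<epsilon> = \<epsilon>" "\<sigma> f = f"
proof -
  interpret field_aut K \<sigma> by fact
  define u w where "u = \<sigma> \<epsilon>" and "w = \<sigma> f"
  have uK: "u \<in> K" "w \<in> K" using in_K gens by (auto simp: u_def w_def)
  have u: "0 < u" "u \<le> \<epsilon>" using less[of 0 \<epsilon>] zero K_closed(1) gens(1) eps_pos eps_le by (auto simp: u_def)
  have w: "\<bar>w - ev1 u (p n)\<bar> \<le> \<epsilon> ^ M n" for n
  proof -
    have "\<sigma> \<bar>f - ev1 \<epsilon> (p n)\<bar> \<le> \<sigma> (\<epsilon> ^ M n)"
      using gens abs K_closed ev1 power f_approx by (intro le) auto
    then have "\<bar>w - ev1 u (p n)\<bar> \<le> u ^ M n"
      using gens abs diff K_closed ev1 power by (simp add: u_def w_def)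
    \<comment> \<open>This is where \<open>\<sigma> \<epsilon> \<le> \<epsilon>\<close> enters: it
      turns the transported approximation into one on the scale of
      \<open>\<epsilon>\<close>.\<close>
    also have "\<dots> \<le> \<epsilon> ^ M n" using u by (intro power_mono) auto
    finally show ?thesis .
  qed
  have "u = \<epsilon>"
  proof (rule ccontr)
    assume "u \<noteq> \<epsilon>"
    obtain P where P: "P \<noteq> 0" "ev3 \<epsilon> f u P = 0" "\<And>T. ev2 \<epsilon> f T \<noteq> u \<Longrightarrow> poly P T \<noteq> 0"
      using alg_minimal[OF alg[OF uK(1)]] by metis
    \<comment> \<open>The image \<open>u\<close> is neither 0 nor \<open>\<epsilon>\<close>, the
      values at the generators of the two forbidden components.\<close>
    have "poly P 0 \<noteq> 0" "poly P [:[:0, 1:]:] \<noteq> 0"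
      using u \<open>u \<noteq> \<epsilon>\<close> by (intro P(3); simp)+
    moreover obtain Q where Q: "Q \<noteq> 0" "ev3 \<epsilon> f w Q = 0"
      using alg[OF uK(2)] by (auto simp: alg_def)
    ultimately have "admissible P Q"
      by (simp add: admissible_def poly_0_coeff_0)
    then obtain N where "\<And>u w. \<bar>u\<bar> \<le> \<epsilon> \<Longrightarrow> (\<And>n. \<bar>w - ev1 u (p n)\<bar> \<le> \<epsilon> ^ M n) \<Longrightarrow>
      \<bar>ev3 \<epsilon> f u P\<bar> \<le> \<epsilon> ^ N \<Longrightarrow> \<bar>ev3 \<epsilon> f w Q\<bar> \<le> \<epsilon> ^ N \<Longrightarrow> False"
      using exclusion by blast
    from this[of u w] show False using u w P(2) Q(2) eps_pos by simp
  qed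
  then show "\<sigma> \<epsilon> = \<epsilon>" by (simp add: u_def)
  show "\<sigma> f = f"
  proof (rule ccontr)
    assume "\<sigma> f \<noteq> f"
    \<comment> \<open>With \<open>u = \<epsilon>\<close>, both \<open>w\<close> and \<open>f\<close>
      are approximated by the same \<open>p n(\<epsilon>)\<close>, so their difference lies below
      every power of \<open>\<epsilon>\<close>; a nonzero algebraic element cannot.\<close>
    then have "w - f \<noteq> 0" "w - f \<in> K" using uK gens K_closed by (auto simp: w_def)
    then obtain N where N: "\<epsilon> ^ N < \<bar>w - f\<bar>" using alg alg_lower by metis
    define n where "n = Suc N"
    have "\<bar>w - f\<bar> \<le> of_nat 2 * \<epsilon> ^ M n"
      using w[of n] f_approx[of n] \<open>u = \<epsilon>\<close> by (simp add: abs_if split: if_splits)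
    also have "\<dots> < \<epsilon> ^ N"
      using M_ge[of n] by (intro eps_power_absorb) (simp add: n_def)
    finally show False using N by simp
  qed
qed

theorem aut_trivial:
  assumes aut: "field_aut K \<sigma>" and alg: "\<And>x. x \<in> K \<Longrightarrow> alg x" and gens: "\<epsilon> \<in> K" "f \<in> K"
    and x: "x \<in> K"
  shows "\<sigma> x = x"
proof -
  interpret field_aut K \<sigma> by fact
  have "\<sigma> \<epsilon> \<le> \<epsilon>"
  proof (rule ccontr)
    interpret inv: field_aut K "inv_into K \<sigma>" by (rule inverse_aut)
    have inv_eps: "inv_into K \<sigma> (\<sigma> \<epsilon>) = \<epsilon>"
      using bij gens(1) by (rule bij_betw_inv_into_left)
    assume "\<not> \<sigma> \<epsilon> \<le> \<epsilon>"
    \<comment> \<open>If \<open>\<sigma>\<close> moved \<open>\<epsilon>\<close> up, its inverse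
      would move it strictly down, and the preceding lemma applied to the inverse gives a
      contradiction.\<close>
    then have less: "inv_into K \<sigma> \<epsilon> < \<epsilon>"
      using inv.less[of \<epsilon> "\<sigma> \<epsilon>"] in_K gens(1) inv_eps by simp
    then have "inv_into K \<sigma> \<epsilon> = \<epsilon>"
      using aut_fixes_generators(1)[OF inverse_aut alg gens] by simp
    then show False using less by simp
  qed
  note fixed = aut_fixes_generators[OF aut alg gens this]
  obtain P where P: "P \<noteq> 0" "ev3 \<epsilon> f x P = 0" using alg[OF x] by (auto simp: alg_def)
  \<comment> \<open>Once the generators are fixed, \<open>\<sigma>\<close> maps the finite set of
    roots of \<open>P\<close> in \<open>K\<close> into itself, preserving the order.\<close>
  define Z where "Z = {z \<in> K. ev3 \<epsilon> f z P = 0}"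
  have "map_poly (ev2 \<epsilon> f) P \<noteq> 0"
    using P(1) ev2_eq_0_iff by (simp add: map_poly_eq_0_iff)
  then have "finite Z"
    using poly_roots_finite[of "map_poly (ev2 \<epsilon> f) P"]
    by (rule_tac finite_subset[of _ "{z. poly (map_poly (ev2 \<epsilon> f) P) z = 0}"]) (auto simp: Z_def peval_def[of "ev2 \<epsilon> f"])
  moreover have "\<sigma> ` Z \<subseteq> Z"
    using ev3[OF gens, of _ P] fixed in_K zero by (fastforce simp: Z_def)
  moreover have "x \<in> Z" using x P by (simp add: Z_def)
  ultimately show ?thesis
    using less by (intro strict_mono_on_finite_fixes[of Z \<sigma>]) (auto simp: Z_def)
qed

end

section \<open>An ultrapower of the reals\<close>

text \<open>Zorn's lemma gives a finest proper filter below \<open>F\<close>. Intersecting it with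
  the set of a predicate either yields the trivial filter or changes nothing, which decides the
  predicate.\<close>

lemma exists_ultrafilter:
  fixes F :: "'a filter"
  assumes "F \<noteq> bot"
  shows "\<exists>U\<le>F. U \<noteq> bot \<and> (\<forall>P. eventually P U \<or> eventually (\<lambda>x. \<not> P x) U)"
proof -
  let ?A = "{G. G \<noteq> bot \<and> G \<le> F}"
  let ?r = "\<lambda>G H. H \<le> G"
  have "\<exists>m\<in>?A. \<forall>a\<in>?A. ?r m a \<longrightarrow> a = m"
  proof (rule predicate_Zorn)
    show "partial_order_on ?A (relation_of ?r ?A)"
      by (rule partial_order_on_relation_ofI) auto
    fix C assume C: "C \<in> Chains (relation_of ?r ?A)"
    then have CA: "C \<subseteq> ?A" and chain: "\<And>G H. G \<in> C \<Longrightarrow> H \<in> C \<Longrightarrow> G \<le> H \<or> H \<le> G"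
      by (auto simp: Chains_def relation_of_def)
    show "\<exists>u\<in>?A. \<forall>a\<in>C. u \<le> a"
    proof (cases "C = {}")
      case True
      then show ?thesis using assms by auto
    next
      case False
      \<comment> \<open>On a nonempty chain, an eventual property of the infimum already holds for
        some member; hence the infimum of proper filters is proper.\<close>
      have "eventually (\<lambda>_. False) (Inf C) \<longleftrightarrow> (\<exists>b\<in>C. eventually (\<lambda>_. False) b)"
        using False chain by (intro eventually_Inf_base) (metis inf.absorb1 inf.absorb2 order_refl)+
      then have "Inf C \<noteq> bot" using CA by (auto simp: trivial_limit_def)
      moreover have "Inf C \<le> F" using False CA by (metis (mono_tags, lifting) Inf_lower2 all_not_in_conv mem_Collect_eq subset_eq)
      ultimately show ?thesis by (auto intro!: bexI[of _ "Inf C"] Inf_lower)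
    qed
  qed
  then obtain U where U: "U \<noteq> bot" "U \<le> F" and min: "\<And>G. G \<noteq> bot \<Longrightarrow> G \<le> F \<Longrightarrow> G \<le> U \<Longrightarrow> G = U"
    by blast
  have "eventually P U \<or> eventually (\<lambda>x. \<not> P x) U" for P
  proof (cases "inf U (principal {x. P x}) = bot")
    case True
    then show ?thesis by (simp add: trivial_limit_def eventually_inf_principal)
  next
    case False
    then have "inf U (principal {x. P x}) = U"
      using U by (intro min) (auto intro: le_infI1)
    then have "U \<le> principal {x. P x}" by (metis inf_le2)
    then show ?thesis by (simp add: le_principal)
  qed
  then show ?thesis using U by blast
qed

text \<open>Refining \<open>sequentially\<close> makes the ultrafilter nonprincipal: whatever holds
  for all large indices holds in the ultrapower.\<close>

definition ultra :: "nat filter" where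
  "ultra = (SOME U. U \<le> sequentially \<and> U \<noteq> bot \<and> (\<forall>P. eventually P U \<or> eventually (\<lambda>x. \<not> P x) U))"

lemma ultra: "ultra \<le> sequentially" "ultra \<noteq> bot"
    "eventually P ultra \<or> eventually (\<lambda>x. \<not> P x) ultra"
proof -
  have "\<exists>U. U \<le> sequentially \<and> U \<noteq> bot \<and> (\<forall>P. eventually P U \<or> eventually (\<lambda>x. \<not> P x) U)"
    using exists_ultrafilter[of sequentially] by auto
  from someI_ex[OF this, folded ultra_def]
  show "ultra \<le> sequentially" "ultra \<noteq> bot" "eventually P ultra \<or> eventually (\<lambda>x. \<not> P x) ultra"
    by auto
qed

lemma not_eventually_ultra: "\<not> eventually P ultra \<longleftrightarrow> eventually (\<lambda>x. \<not> P x) ultra"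
  using ultra(2) ultra(3)[of P] eventually_conj[of P ultra "\<lambda>x. \<not> P x"] by (auto simp: trivial_limit_def)

lemma eventually_ultra_disj:
  "eventually P ultra \<or> eventually Q ultra \<longleftrightarrow> eventually (\<lambda>x. P x \<or> Q x) ultra"
proof -
  have "\<not> (eventually P ultra \<or> eventually Q ultra) \<longleftrightarrow> \<not> eventually (\<lambda>x. P x \<or> Q x) ultra"
    by (simp add: not_eventually_ultra eventually_conj_iff)
  then show ?thesis by blast
qed

section \<open>The ultrapower as an ordered field\<close>

definition ultra_eq :: "(nat \<Rightarrow> real) \<Rightarrow> (nat \<Rightarrow> real) \<Rightarrow> bool" where
  "ultra_eq s t \<longleftrightarrow> eventually (\<lambda>n. s n = t n) ultra"

quotient_type hyperreal = "nat \<Rightarrow> real" / ultra_eq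
  morphisms rep_hyperreal hyp
proof (rule equivpI)
  show "reflp ultra_eq" by (simp add: reflp_def ultra_eq_def)
  show "symp ultra_eq" by (auto simp: symp_def ultra_eq_def eq_commute)
  show "transp ultra_eq"
    unfolding transp_def ultra_eq_def by (auto elim: eventually_elim2)
qed

instantiation hyperreal :: linordered_field
begin

lift_definition zero_hyperreal :: hyperreal is "\<lambda>_. 0" .
lift_definition one_hyperreal :: hyperreal is "\<lambda>_. 1" .
lift_definition plus_hyperreal :: "hyperreal \<Rightarrow> hyperreal \<Rightarrow> hyperreal" is "\<lambda>s t n. s n + t n"
  unfolding ultra_eq_def by (auto elim: eventually_elim2)
lift_definition minus_hyperreal :: "hyperreal \<Rightarrow> hyperreal \<Rightarrow> hyperreal" is "\<lambda>s t n. s n - t n"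
  unfolding ultra_eq_def by (auto elim: eventually_elim2)
lift_definition times_hyperreal :: "hyperreal \<Rightarrow> hyperreal \<Rightarrow> hyperreal" is "\<lambda>s t n. s n * t n"
  unfolding ultra_eq_def by (auto elim: eventually_elim2)
lift_definition divide_hyperreal :: "hyperreal \<Rightarrow> hyperreal \<Rightarrow> hyperreal" is "\<lambda>s t n. s n / t n"
  unfolding ultra_eq_def by (auto elim: eventually_elim2)
lift_definition uminus_hyperreal :: "hyperreal \<Rightarrow> hyperreal" is "\<lambda>s n. - s n"
  unfolding ultra_eq_def by (auto elim: eventually_mono)
lift_definition inverse_hyperreal :: "hyperreal \<Rightarrow> hyperreal" is "\<lambda>s n. inverse (s n)"
  unfolding ultra_eq_def by (auto elim: eventually_mono)
lift_definition abs_hyperreal :: "hyperreal \<Rightarrow> hyperreal" is "\<lambda>s n. \<bar>s n\<bar>"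
  unfolding ultra_eq_def by (auto elim: eventually_mono)
lift_definition sgn_hyperreal :: "hyperreal \<Rightarrow> hyperreal" is "\<lambda>s n. sgn (s n)"
  unfolding ultra_eq_def by (auto elim: eventually_mono)
lift_definition less_eq_hyperreal :: "hyperreal \<Rightarrow> hyperreal \<Rightarrow> bool"
  is "\<lambda>s t. eventually (\<lambda>n. s n \<le> t n) ultra"
  unfolding ultra_eq_def
  by (rule eventually_subst) (auto elim: eventually_elim2)
lift_definition less_hyperreal :: "hyperreal \<Rightarrow> hyperreal \<Rightarrow> bool"
  is "\<lambda>s t. eventually (\<lambda>n. s n < t n) ultra"
  unfolding ultra_eq_def
  by (rule eventually_subst) (auto elim: eventually_elim2)

instance
proof
  fix a b c :: hyperreal
  show "a + b + c = a + (b + c)" by transfer (simp add: ultra_eq_def)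
  show "a + b = b + a" by transfer (simp add: ultra_eq_def add.commute)
  show "0 + a = a" by transfer (simp add: ultra_eq_def)
  show "- a + a = 0" by transfer (simp add: ultra_eq_def)
  show "a - b = a + - b" by transfer (simp add: ultra_eq_def)
  show "a * b * c = a * (b * c)" by transfer (simp add: ultra_eq_def)
  show "a * b = b * a" by transfer (simp add: ultra_eq_def mult.commute)
  show "1 * a = a" by transfer (simp add: ultra_eq_def)
  show "(a + b) * c = a * c + b * c" by transfer (simp add: ultra_eq_def distrib_right)
  show "(0 :: hyperreal) \<noteq> 1" by transfer (simp add: ultra_eq_def trivial_limit_def[symmetric] ultra(2))
  show "a \<noteq> 0 \<Longrightarrow> inverse a * a = 1"
    by transfer (auto simp: ultra_eq_def not_eventually_ultra elim: eventually_mono)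
  show "inverse (0 :: hyperreal) = 0" by transfer (simp add: ultra_eq_def)
  show "a div b = a * inverse b" by transfer (simp add: ultra_eq_def divide_inverse)
  show "(a < b) = (a \<le> b \<and> \<not> b \<le> a)"
    by transfer (auto simp: not_eventually_ultra not_le elim: eventually_mono)
  show "a \<le> a" by transfer simp
  show "a \<le> b \<Longrightarrow> b \<le> c \<Longrightarrow> a \<le> c" by transfer (auto elim: eventually_elim2)
  show "a \<le> b \<Longrightarrow> b \<le> a \<Longrightarrow> a = b" by transfer (auto simp: ultra_eq_def elim: eventually_elim2)
  show "a \<le> b \<or> b \<le> a" by transfer (simp add: eventually_ultra_disj linear)
  show "a \<le> b \<Longrightarrow> c + a \<le> c + b" by transfer simp
  show "a < b \<Longrightarrow> 0 < c \<Longrightarrow> c * a < c * b" by transfer (auto elim: eventually_elim2)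
  show "\<bar>a\<bar> = (if a < 0 then - a else a)"
  proof (cases "a < 0")
    case True
    then have "\<bar>a\<bar> = - a" by transfer (auto simp: ultra_eq_def elim: eventually_mono)
    then show ?thesis using True by simp
  next
    case False
    then have "\<bar>a\<bar> = a"
      by transfer (auto simp: ultra_eq_def not_eventually_ultra elim: eventually_mono)
    then show ?thesis using False by simp
  qed
  show "sgn a = (if a = 0 then 0 else if 0 < a then 1 else - 1)"
  proof -
    consider "a = 0" | "a \<noteq> 0" "0 < a" | "a \<noteq> 0" "\<not> 0 < a" by blast
    then show ?thesis
    proof cases
      case 1
      have "sgn (0 :: hyperreal) = 0" by transfer (simp add: ultra_eq_def)
      then show ?thesis using 1 by simp
    next
      case 2
      then have "sgn a = 1" by transfer (auto simp: ultra_eq_def elim: eventually_mono)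
      then show ?thesis using 2 by simp
    next
      case 3
      then have "sgn a = - 1"
        by transfer (auto simp: ultra_eq_def not_eventually_ultra sgn_if elim: eventually_elim2)
      then show ?thesis using 3 by simp
    qed
  qed
qed (transfer; simp add: ultra_eq_def algebra_simps)+

end

section \<open>Coordinatewise computation\<close>

lemma hyp_eq_iff: "hyp s = hyp t \<longleftrightarrow> eventually (\<lambda>n. s n = t n) ultra"
  by (simp add: hyperreal.abs_eq_iff ultra_eq_def)

lemmas hyp_simps = plus_hyperreal.abs_eq minus_hyperreal.abs_eq times_hyperreal.abs_eq
  divide_hyperreal.abs_eq uminus_hyperreal.abs_eq abs_hyperreal.abs_eq
  less_eq_hyperreal.abs_eq less_hyperreal.abs_eq

lemma hyp_const: "0 = hyp (\<lambda>_. 0)" "1 = hyp (\<lambda>_. 1)"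
  by (simp_all add: zero_hyperreal_def one_hyperreal_def)

lemma hyp_surj: obtains s where "x = hyp s"
  using Quotient3_abs_rep[OF Quotient3_hyperreal, of x] by metis

lemma of_nat_hyp: "of_nat n = hyp (\<lambda>_. of_nat n)"
  by (induction n) (simp_all add: hyp_const hyp_simps)

lemma of_rat_hyp: "of_rat r = hyp (\<lambda>_. of_rat r)"
proof (cases r)
  case (Fract a b)
  have int: "of_int n = hyp (\<lambda>_. of_int n)" for n
    by (cases n rule: int_cases2) (simp_all add: of_nat_hyp hyp_simps)
  show ?thesis
    using Fract by (simp add: of_rat_rat int hyp_simps)
qed

lemma power_hyp: "hyp s ^ k = hyp (\<lambda>n. s n ^ k)"
  by (induction k) (simp_all add: hyp_const hyp_simps)

lemma sum_hyp: "(\<Sum>i\<in>A. hyp (s i)) = hyp (\<lambda>n. \<Sum>i\<in>A. s i n)"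
  by (induction A rule: infinite_finite_induct) (simp_all add: hyp_const hyp_simps)

lemma ev1_hyp: "ev1 (hyp s) R = hyp (\<lambda>n. ev1 (s n) R)"
proof (induction R)
  case 0
  then show ?case by (simp add: hyp_const)
next
  case (pCons a R)
  then show ?case by (simp add: of_rat_hyp[of a] hyp_simps)
qed

section \<open>Roots in the ultrapower\<close>

lemma hyperreal_sqrt:
  fixes x :: hyperreal
  assumes "0 \<le> x"
  obtains y where "x = y * y"
proof -
  obtain s where s: "x = hyp s" by (rule hyp_surj)
  have "eventually (\<lambda>n. 0 \<le> s n) ultra" using assms by (simp add: s hyp_const hyp_simps)
  then have "x = hyp (\<lambda>n. sqrt (s n)) * hyp (\<lambda>n. sqrt (s n))"
    by (auto simp: s hyp_simps hyp_eq_iff elim: eventually_mono)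
  then show ?thesis by (rule that)
qed

lemma odd_degree_real_root:
  fixes q :: "real poly"
  assumes "odd (degree q)"
  shows "\<exists>x. poly q x = 0"
proof -
  have pos: "\<exists>x. poly q x = 0" if odd: "odd (degree q)" and lc: "lead_coeff q > 0" for q :: "real poly"
  proof -
    \<comment> \<open>The reflection -q(-x) has the same leading coefficient in odd degree, so its
      positivity far to the right makes \<open>q\<close> negative far to the left.\<close>
    define r where "r = - pcompose q [:0, -1:]"
    have "lead_coeff r = lead_coeff q"
      using odd by (simp add: r_def lead_coeff_comp)
    then have "lead_coeff r > 0" using lc by simp
    obtain a b where a: "\<And>x. a \<le> x \<Longrightarrow> lead_coeff q \<le> poly q x"
      and b: "\<And>x. b \<le> x \<Longrightarrow> lead_coeff r \<le> poly r x"
      using poly_pinfty_gt_lc lc \<open>lead_coeff r > 0\<close> by metis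
    define c where "c = max 1 (max a b)"
    have c: "a \<le> c" "b \<le> c" "0 < c" by (auto simp: c_def)
    have "0 < poly q c" using a[OF c(1)] lc by linarith
    moreover have "poly r c = - poly q (- c)" by (simp add: r_def poly_pcompose)
    then have "poly q (- c) < 0"
      using b[OF c(2)] \<open>lead_coeff r > 0\<close> by linarith
    moreover have "- c < c" using c by simp
    ultimately show ?thesis using poly_IVT_pos by blast
  qed
  show ?thesis
  proof (cases "lead_coeff q > 0")
    case True
    then show ?thesis using pos assms by blast
  next
    case False
    then have "lead_coeff (- q) > 0" using assms by (cases "q = 0") (auto simp: not_less less_le)
    then show ?thesis using pos[of "- q"] assms by auto
  qed
qed

lemma hyperreal_odd_root:
  fixes a :: "nat \<Rightarrow> hyperreal"
  assumes "odd n" "a n \<noteq> 0"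
  obtains x where "(\<Sum>i\<le>n. a i * x ^ i) = 0"
proof -
  define s where "s i = rep_hyperreal (a i)" for i
  have s: "a i = hyp (s i)" for i
    by (simp add: s_def Quotient3_abs_rep[OF Quotient3_hyperreal])
  \<comment> \<open>The equation is solved in each coordinate where the leading coefficient is
    nonzero; elsewhere any value will do, since those coordinates are negligible.\<close>
  have "\<exists>x. s n k \<noteq> 0 \<longrightarrow> (\<Sum>i\<le>n. s i k * x ^ i) = 0" for k
  proof (cases "s n k = 0")
    case False
    define q where "q = (\<Sum>i\<le>n. monom (s i k) i)"
    have "coeff q j = (if j \<le> n then s j k else 0)" for j
      by (simp add: q_def coeff_sum sum.delta)
    then have "degree q = n"
      using False by (intro antisym degree_le le_degree) auto
    then obtain x where "poly q x = 0" using odd_degree_real_root assms(1) by blast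
    then show ?thesis by (auto simp: q_def poly_sum poly_monom)
  qed simp
  then obtain x where x: "\<And>k. s n k \<noteq> 0 \<Longrightarrow> (\<Sum>i\<le>n. s i k * x k ^ i) = 0" by metis
  have "eventually (\<lambda>k. s n k \<noteq> 0) ultra"
    using assms(2) by (simp add: s hyp_const hyp_eq_iff not_eventually_ultra)
  then have "(\<Sum>i\<le>n. a i * hyp x ^ i) = 0"
    by (auto simp: s hyp_const power_hyp hyp_simps sum_hyp hyp_eq_iff x elim: eventually_mono)
  then show ?thesis by (rule that)
qed

text \<open>This provides coordinate \<open>k\<close> of the pair: a small real \<open>e\<close>
  meets the first \<open>k\<close> requirements, with \<open>p k\<close> standing in for the
  limit.\<close>

lemma exists_real_approximation:
  fixes p :: "nat \<Rightarrow> rat poly" and M :: "nat \<Rightarrow> nat"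
  assumes "\<And>m n. m \<le> n \<Longrightarrow> [:0, 1:] ^ Suc (M m) dvd p n - p m"
  shows "\<exists>e::real. 0 < e \<and> of_nat k * e < 1 \<and> (\<forall>n\<le>k. \<bar>ev1 e (p k) - ev1 e (p n)\<bar> \<le> e ^ M n)"
proof -
  define q where "q n = (p k - p n) div [:0, 1:] ^ Suc (M n)" for n
  have q: "p k - p n = [:0, 1:] ^ Suc (M n) * q n" if "n \<le> k" for n
    using assms[OF that] by (simp only: q_def dvd_mult_div_cancel)
  have "\<exists>C::nat \<Rightarrow> nat. \<forall>n. \<forall>x::real. \<bar>x\<bar> \<le> 1 \<longrightarrow> \<bar>ev1 x (q n)\<bar> \<le> of_nat (C n)"
    by (rule choice) (use ev_bound(1)[where ?'a = real] in blast)
  then obtain C :: "nat \<Rightarrow> nat" where C: "\<And>n x::real. \<bar>x\<bar> \<le> 1 \<Longrightarrow> \<bar>ev1 x (q n)\<bar> \<le> of_nat (C n)"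
    by blast
  \<comment> \<open>\<open>D\<close> dominates \<open>k\<close> and every \<open>C n\<close> with
    \<open>n \<le> k\<close>, so \<open>e\<close> times any of these stays below 1. The spare factor
    \<open>e\<close> can then absorb \<open>C n\<close>.\<close>
  define D where "D = k + (\<Sum>n\<le>k. C n)"
  define e where "e = 1 / (1 + real D)"
  have e: "0 < e" "e \<le> 1" by (auto simp: e_def)
  have small: "of_nat m * e < 1" if "m \<le> D" for m using that by (simp add: e_def field_simps)
  have "\<bar>ev1 e (p k) - ev1 e (p n)\<bar> \<le> e ^ M n" if n: "n \<le> k" for n
  proof -
    have "C n \<le> D" using member_le_sum[of n "{..k}" C] n by (simp add: D_def)
    have "ev1 e (p k) - ev1 e (p n) = ev1 e (p k - p n)" by (simp add: ev1_hom)
    also have "\<dots> = e ^ Suc (M n) * ev1 e (q n)" unfolding q[OF n] ev1_hom by simp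
    finally have "\<bar>ev1 e (p k) - ev1 e (p n)\<bar> = e ^ M n * (\<bar>ev1 e (q n)\<bar> * e)"
      using e by (simp add: abs_mult)
    also have "\<dots> \<le> e ^ M n * (of_nat (C n) * e)"
      using e C[of e n] by (intro mult_left_mono mult_right_mono) auto
    also have "\<dots> \<le> e ^ M n * 1"
      using e small[OF \<open>C n \<le> D\<close>] by (intro mult_left_mono) auto
    finally show ?thesis by simp
  qed
  moreover have "of_nat k * e < 1" by (rule small) (simp add: D_def)
  ultimately show ?thesis using e by blast
qed

theorem exists_generic_pair:
  obtains p M and \<epsilon> f :: hyperreal where "generic_pair p M \<epsilon> f"
proof (rule exists_diagonal_sequence)
  fix p :: "nat \<Rightarrow> rat poly" and M :: "nat \<Rightarrow> nat"
  assume pM: "p 0 = 0" "strict_mono M" "\<And>m n. m \<le> n \<Longrightarrow> [:0, 1:] ^ Suc (M m) dvd p n - p m"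
    "\<And>P Q. admissible P Q \<Longrightarrow> \<exists>n. excludes (p n) (M n) P Q"
  have "\<exists>e::nat \<Rightarrow> real. \<forall>k. 0 < e k \<and> of_nat k * e k < 1 \<and>
      (\<forall>n\<le>k. \<bar>ev1 (e k) (p k) - ev1 (e k) (p n)\<bar> \<le> e k ^ M n)"
    by (rule choice, rule allI, rule exists_real_approximation[OF pM(3)])
  then obtain e :: "nat \<Rightarrow> real" where e: "\<And>k. 0 < e k" "\<And>k. of_nat k * e k < 1"
    "\<And>k n. n \<le> k \<Longrightarrow> \<bar>ev1 (e k) (p k) - ev1 (e k) (p n)\<bar> \<le> e k ^ M n"
    by blast
  \<comment> \<open>Coordinate \<open>k\<close> meets requirements \<open>0\<close> to
    \<open>k\<close>, so each single requirement holds from some index on and hence in the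
    ultrapower.\<close>
  have seq: "eventually P ultra" if "\<And>k. n \<le> k \<Longrightarrow> P k" for P n
    using that by (intro filter_leD[OF ultra(1)] eventually_sequentiallyI)
  have "generic_pair p M (hyp e) (hyp (\<lambda>k. ev1 (e k) (p k)))"
  proof
    show "0 < hyp e" by (auto simp: hyp_const hyp_simps e intro: seq)
    show "of_nat n * hyp e < 1" for n
    proof -
      have "real n * e k < 1" if "n \<le> k" for k
      proof -
        have "real n * e k \<le> real k * e k" using that e(1)[of k] by (intro mult_right_mono) auto
        then show ?thesis using e(2)[of k] by simp
      qed
      then show ?thesis by (auto simp: of_nat_hyp hyp_const hyp_simps intro: seq[of n])
    qed
    show "\<bar>hyp (\<lambda>k. ev1 (e k) (p k)) - ev1 (hyp e) (p n)\<bar> \<le> hyp e ^ M n" for n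
      by (auto simp: ev1_hyp power_hyp hyp_simps e(3) intro: seq[of n])
  qed (use pM in auto)
  then show ?thesis by (rule that)
qed

section \<open>The relative algebraic closure\<close>

text \<open>The ring structure pulled back along \<open>d\<close>. It puts a countable subfield on
  \<open>nat\<close>, and with \<open>d\<close> the identity it presents a type-class field as an
  algebraic structure with a carrier.\<close>

definition transport :: "('b \<Rightarrow> 'a::field) \<Rightarrow> 'b ring" where
  "transport d = \<lparr>carrier = UNIV, monoid.mult = (\<lambda>x y. inv_into UNIV d (d x * d y)), one = inv_into UNIV d 1,
     zero = inv_into UNIV d 0, add = (\<lambda>x y. inv_into UNIV d (d x + d y))\<rparr>"

locale field_embedding =
  fixes d :: "'b \<Rightarrow> 'a::field"
  assumes inj_d: "inj d" and range_d: "subfield_set (range d)"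
begin

abbreviation (input) "N \<equiv> transport d"

lemmas range_closed = subfield_setD[OF range_d]

lemma d_inv: "x \<in> range d \<Longrightarrow> d (inv_into UNIV d x) = x"
  by (rule f_inv_into_f)

lemma d_eq_iff: "d x = d y \<longleftrightarrow> x = y"
  using inj_d by (simp add: inj_eq)

lemma carrier_N [simp]: "carrier N = UNIV"
  by (simp add: transport_def)

lemma d_ops:
  "d (x \<otimes>\<^bsub>N\<^esub> y) = d x * d y" "d (x \<oplus>\<^bsub>N\<^esub> y) = d x + d y" "d \<one>\<^bsub>N\<^esub> = 1" "d \<zero>\<^bsub>N\<^esub> = 0"
  using range_closed by (simp_all add: transport_def d_inv)

lemma cring_N: "cring N"
proof (intro cringI abelian_groupI comm_monoidI)
  fix x
  have "- d x \<in> range d" using range_closed by simp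
  then obtain y where "- d x = d y" by blast
  then show "\<exists>y\<in>carrier N. y \<oplus>\<^bsub>N\<^esub> x = \<zero>\<^bsub>N\<^esub>"
    by (metis UNIV_I carrier_N ab_left_minus d_eq_iff d_ops(2,4))
qed (simp_all add: d_ops algebra_simps flip: d_eq_iff)

lemma field_N: "field N"
proof (rule cring.cring_fieldI2[OF cring_N])
  show "\<zero>\<^bsub>N\<^esub> \<noteq> \<one>\<^bsub>N\<^esub>" by (simp add: d_ops flip: d_eq_iff)
  fix a assume "a \<noteq> \<zero>\<^bsub>N\<^esub>"
  then have a: "d a \<noteq> 0" by (simp add: d_ops flip: d_eq_iff)
  have "inverse (d a) \<in> range d" using range_closed by simp
  then obtain b where "inverse (d a) = d b" by blast
  then have "a \<otimes>\<^bsub>N\<^esub> b = \<one>\<^bsub>N\<^esub>" using a by (metis d_eq_iff d_ops(1,3) right_inverse)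
  then show "\<exists>b\<in>carrier N. a \<otimes>\<^bsub>N\<^esub> b = \<one>\<^bsub>N\<^esub>" by auto
qed

lemma d_uminus: "d (\<ominus>\<^bsub>N\<^esub> x) = - d x"
proof -
  interpret cring N by (rule cring_N)
  have "d (\<ominus>\<^bsub>N\<^esub> x) + d x = 0" using l_neg[of x] d_ops by (metis UNIV_I carrier_N)
  then show ?thesis by (simp add: eq_neg_iff_add_eq_0)
qed

lemma d_minus: "d (x \<ominus>\<^bsub>N\<^esub> y) = d x - d y"
  by (simp add: a_minus_def d_ops d_uminus)

lemma d_inverse: "d x \<noteq> 0 \<Longrightarrow> d (inv\<^bsub>N\<^esub> x) = inverse (d x)"
proof -
  interpret field N by (rule field_N)
  assume x: "d x \<noteq> 0"
  then have "x \<in> Units N" using field_Units d_ops(4) by auto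
  then have "d (inv\<^bsub>N\<^esub> x) * d x = 1" using Units_l_inv d_ops by metis
  then show ?thesis using inverse_unique by (metis mult.commute)
qed

lemma d_power: "d (x [^]\<^bsub>N\<^esub> (n::nat)) = d x ^ n"
proof -
  interpret field N by (rule field_N)
  show ?thesis by (induction n) (simp_all add: d_ops)
qed

lemma d_finsum: "finite A \<Longrightarrow> d (finsum N g A) = (\<Sum>i\<in>A. d (g i))"
proof -
  interpret field N by (rule field_N)
  show "finite A \<Longrightarrow> ?thesis"
    by (induction A rule: finite_induct) (simp_all add: d_ops)
qed

lemma d_add_pow_nat: "d (add_pow N (n::nat) x) = of_nat n * d x"
proof -
  interpret field N by (rule field_N)
  show ?thesis by (induction n) (simp_all add: add_pow_def d_ops algebra_simps)
qed

lemma d_add_pow_int: "d (add_pow N (n::int) x) = of_int n * d x"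
proof -
  interpret field N by (rule field_N)
  show ?thesis
  proof (cases "n \<ge> 0")
    case True
    then show ?thesis using d_add_pow_nat[of "nat n" x] by (simp add: add_pow_int_ge)
  next
    case False
    then show ?thesis using d_add_pow_nat[of "nat (- n)" x] by (simp add: add_pow_int_lt d_uminus)
  qed
qed

end

interpretation id_field: field_embedding "\<lambda>x::'a::field. x"
  by standard (auto simp: subfield_set_def)

lemmas field_ring_simps = id_field.d_ops id_field.d_uminus id_field.d_minus id_field.d_power

text \<open>Polynomials over a carrier are lists with the leading coefficient first, whereas
  \<open>Poly\<close> expects the constant term first; hence \<open>rev\<close>.\<close>

lemma eval_field_ring:
  "ring.eval (transport (\<lambda>x::'a::field. x)) cs x = poly (Poly (rev cs)) x"
proof -
  interpret field "transport (\<lambda>x::'a. x)" by (rule id_field.field_N)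
  show ?thesis
    by (induction cs) (simp_all add: field_ring_simps Poly_append poly_monom mult.commute)
qed

section \<open>The field generated by the pair and its algebraic elements\<close>

context generic_pair
begin

definition base :: "'a set" where
  "base = {ev2 \<epsilon> f a / ev2 \<epsilon> f b | a b. b \<noteq> 0}"

lemma baseI: "b \<noteq> 0 \<Longrightarrow> ev2 \<epsilon> f a / ev2 \<epsilon> f b \<in> base"
  by (auto simp: base_def)

lemma ev2_in_base: "ev2 \<epsilon> f a \<in> base"
  using baseI[of 1 a] by (simp add: ev2_hom)

lemma subfield_base: "subfield base (transport (\<lambda>x::'a. x))"
proof -
  interpret field "transport (\<lambda>x::'a. x)" by (rule id_field.field_N)
  show ?thesis
  proof (rule subfieldI'[OF subringI])
    show "base \<subseteq> carrier (transport (\<lambda>x. x))" by simp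
    show "\<one>\<^bsub>transport (\<lambda>x. x)\<^esub> \<in> base"
      using ev2_in_base[of 1] by (simp add: field_ring_simps ev2_hom)
    show "\<ominus>\<^bsub>transport (\<lambda>x. x)\<^esub> h \<in> base" if h_base: "h \<in> base" for h
    proof -
      obtain a b where "h = ev2 \<epsilon> f a / ev2 \<epsilon> f b" "b \<noteq> 0" using h_base by (auto simp: base_def)
      then show ?thesis using baseI[of b "- a"] by (simp add: field_ring_simps ev2_hom)
    qed
    show "h \<otimes>\<^bsub>transport (\<lambda>x. x)\<^esub> h' \<in> base" "h \<oplus>\<^bsub>transport (\<lambda>x. x)\<^esub> h' \<in> base"
      if hh: "h \<in> base" "h' \<in> base" for h h'
    proof -
      obtain a b where h: "h = ev2 \<epsilon> f a / ev2 \<epsilon> f b" "b \<noteq> 0" using hh(1) by (auto simp: base_def)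
      obtain a' b' where h': "h' = ev2 \<epsilon> f a' / ev2 \<epsilon> f b'" "b' \<noteq> 0" using hh(2) by (auto simp: base_def)
      show "h \<otimes>\<^bsub>transport (\<lambda>x. x)\<^esub> h' \<in> base"
        using baseI[of "b * b'" "a * a'"] h h' by (simp add: field_ring_simps ev2_hom)
      have "h + h' = ev2 \<epsilon> f (a * b' + a' * b) / ev2 \<epsilon> f (b * b')"
        using h h' by (simp add: ev2_hom ev2_eq_0_iff add_frac_eq)
      then show "h \<oplus>\<^bsub>transport (\<lambda>x. x)\<^esub> h' \<in> base"
        using baseI[of "b * b'"] h h' by (simp add: field_ring_simps)
    qed
    show "inv\<^bsub>transport (\<lambda>x. x)\<^esub> k \<in> base" if k_base: "k \<in> base - {\<zero>\<^bsub>transport (\<lambda>x. x)\<^esub>}" for k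
    proof -
      obtain a b where k: "k = ev2 \<epsilon> f a / ev2 \<epsilon> f b" "b \<noteq> 0" using k_base by (auto simp: base_def)
      have "k \<noteq> 0" using k_base by (simp add: field_ring_simps)
      then have "a \<noteq> 0" using k by (auto simp: ev2_hom)
      then show ?thesis
        using baseI[of a b] k \<open>k \<noteq> 0\<close> by (simp add: id_field.d_inverse)
    qed
  qed
qed

lemma clear_denominators:
  assumes "set cs \<subseteq> base"
  shows "\<exists>b P. b \<noteq> 0 \<and> map_poly (ev2 \<epsilon> f) P = smult (ev2 \<epsilon> f b) (Poly (rev cs))"
  using assms
proof (induction cs)
  case Nil
  show ?case by (intro exI[of _ 1] exI[of _ 0]) simp
next
  case (Cons c cs)
  then obtain b P where P: "b \<noteq> 0" "map_poly (ev2 \<epsilon> f) P = smult (ev2 \<epsilon> f b) (Poly (rev cs))"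
    by auto
  obtain u v where c: "c = ev2 \<epsilon> f u / ev2 \<epsilon> f v" "v \<noteq> 0" using Cons.prems by (auto simp: base_def)
  \<comment> \<open>The new head \<open>c = u / v\<close> is the coefficient of degree
    \<open>length cs\<close>; multiplying by \<open>b * v\<close> clears its denominator along with
    those of the tail.\<close>
  have "map_poly (ev2 \<epsilon> f) (smult v P + monom (b * u) (length cs)) =
      smult (ev2 \<epsilon> f (b * v)) (Poly (rev (c # cs)))"
  proof (rule poly_eqI)
    fix n
    have "ev2 \<epsilon> f (coeff P n) = ev2 \<epsilon> f b * coeff (Poly (rev cs)) n"
      using arg_cong[OF P(2), of "\<lambda>p. coeff p n"] by (simp add: coeff_map_poly ev2_hom)
    then show "coeff (map_poly (ev2 \<epsilon> f) (smult v P + monom (b * u) (length cs))) n =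
        coeff (smult (ev2 \<epsilon> f (b * v)) (Poly (rev (c # cs)))) n"
      using c by (simp add: coeff_map_poly ev2_hom ev2_eq_0_iff Poly_append field_simps coeff_monom_mult
          coeff_pCons split: nat.split)
  qed
  moreover have "b * v \<noteq> 0" using P c by simp
  ultimately show ?case by blast
qed

text \<open>Bridge to the theory of finite extensions, from which closure under field operations and
  transitivity of algebraicity are drawn.\<close>

lemma alg_iff_algebraic:
  "alg x \<longleftrightarrow> (ring.algebraic (transport (\<lambda>x::'a. x)) over base) x"
proof -
  interpret field "transport (\<lambda>x::'a. x)" by (rule id_field.field_N)
  have subring: "subring base (transport (\<lambda>x::'a. x))"
    using subfield_base by (rule subfieldE)
  show ?thesis
  proof
    assume "alg x"
    then obtain P where P: "P \<noteq> 0" "ev3 \<epsilon> f x P = 0" by (auto simp: alg_def)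
    define cs where "cs = rev (map (ev2 \<epsilon> f) (coeffs P))"
    have cs: "cs \<noteq> []" using P by (simp add: cs_def)
    have "lead_coeff P \<noteq> 0" using P by simp
    then have "hd cs \<noteq> 0"
      using P by (simp add: cs_def hd_rev last_map last_coeffs_eq_coeff_degree ev2_eq_0_iff)
    moreover have "set cs \<subseteq> base" by (auto simp: cs_def ev2_in_base)
    ultimately have "cs \<in> carrier (base[X]\<^bsub>transport (\<lambda>x::'a. x)\<^esub>)"
      using cs unfolding univ_poly_carrier[symmetric] polynomial_def by (simp add: field_ring_simps)
    moreover have "eval cs x = \<zero>\<^bsub>transport (\<lambda>x. x)\<^esub>"
      using P(2) by (simp add: eval_field_ring cs_def field_ring_simps peval_def map_poly_def)
    ultimately show "(algebraic over base) x" using cs by (intro algebraicI)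
  next
    assume "(algebraic over base) x"
    then obtain cs where cs: "cs \<in> carrier (base[X]\<^bsub>transport (\<lambda>x::'a. x)\<^esub>)" "cs \<noteq> []"
      "eval cs x = \<zero>\<^bsub>transport (\<lambda>x. x)\<^esub>"
      using algebraicE[OF subring, of x] by auto
    have cs_base: "set cs \<subseteq> base" "hd cs \<noteq> 0"
      using cs(1,2) unfolding univ_poly_carrier[symmetric] polynomial_def by (simp_all add: field_ring_simps)
    obtain b P where P: "b \<noteq> 0" "map_poly (ev2 \<epsilon> f) P = smult (ev2 \<epsilon> f b) (Poly (rev cs))"
      using clear_denominators[OF cs_base(1)] by blast
    have "ev3 \<epsilon> f x P = 0"
      using cs(3) by (simp add: peval_def[of "ev2 \<epsilon> f"] P(2) eval_field_ring field_ring_simps)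
    moreover have "Poly (rev cs) \<noteq> 0"
    proof
      assume "Poly (rev cs) = 0"
      then obtain n where "rev cs = replicate n 0" by (auto simp: Poly_eq_0)
      then have "cs = replicate n 0" by (metis rev_replicate rev_rev_ident)
      then show False using cs(2) cs_base(2) by (cases n) simp_all
    qed
    then have "P \<noteq> 0" using P by (auto simp: ev2_eq_0_iff)
    ultimately show "alg x" by (auto simp: alg_def)
  qed
qed

lemma subfield_alg: "subfield_set {x. alg x}"
proof -
  interpret field "transport (\<lambda>x::'a. x)" by (rule id_field.field_N)
  have "subfield {x. alg x} (transport (\<lambda>x::'a. x))"
    using subfield_of_algebraics[OF subfield_base] by (simp add: alg_iff_algebraic)
  then have sub: "subring {x. alg x} (transport (\<lambda>x::'a. x))"
    and inv: "\<And>k. alg k \<Longrightarrow> k \<noteq> 0 \<Longrightarrow> alg (inv\<^bsub>transport (\<lambda>x::'a. x)\<^esub> k)"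
    using subfieldE(1) subfield_m_inv(1)[of "{x. alg x}"] by (auto simp: field_ring_simps)
  note closed = subringE[OF sub, simplified, unfolded field_ring_simps]
  have "alg (a - b)" if "alg a" "alg b" for a b
    using closed that by (metis diff_conv_add_uminus)
  moreover have "alg (inverse a)" if "alg a" for a
    using inv[OF that] that closed by (cases "a = 0") (auto simp: id_field.d_inverse)
  ultimately show ?thesis
    using closed by (auto simp: subfield_set_def)
qed

text \<open>Transitivity of algebraicity: the coefficients generate a finite extension
  \<open>F\<close> of \<open>base\<close>, and adjoining \<open>x\<close> to \<open>F\<close> is
  again finite, so \<open>x\<close> lies in a finite extension of \<open>base\<close>.\<close>

lemma alg_root:
  assumes a: "\<And>i. i \<le> n \<Longrightarrow> alg (a i)" and nz: "a n \<noteq> 0" and root: "(\<Sum>i\<le>n. a i * x ^ i) = 0"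
  shows "alg x"
proof -
  interpret field "transport (\<lambda>x::'a. x)" by (rule id_field.field_N)
  define as where "as = map a [0..<Suc n]"
  define F where "F = finite_extension base as"
  have alg_as: "(algebraic over base) y" if "y \<in> set as" for y
    using that a by (auto simp: as_def alg_iff_algebraic)
  have F: "subfield F (transport (\<lambda>x::'a. x))" "finite_dimension base F"
    unfolding F_def
    using finite_extension_is_subfield[OF subfield_base _ alg_as]
      finite_extension_finite_dimension(1)[OF subfield_base _ alg_as] by simp_all
  have "set as \<subseteq> F"
    unfolding F_def using finite_extension_mem[OF subfieldE(1)[OF subfield_base]] by simp
  define cs where "cs = rev as"
  have cs: "set cs \<subseteq> F" "cs \<noteq> []" "hd cs \<noteq> 0"
    using \<open>set as \<subseteq> F\<close> nz by (auto simp: cs_def as_def)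
  then have "cs \<in> carrier (F[X]\<^bsub>transport (\<lambda>x::'a. x)\<^esub>)"
    unfolding univ_poly_carrier[symmetric] polynomial_def by (simp add: field_ring_simps)
  moreover have "eval cs x = \<zero>\<^bsub>transport (\<lambda>x. x)\<^esub>"
  proof -
    have "poly (Poly (map a [0..<m])) x = (\<Sum>i<m. a i * x ^ i)" for m
      by (induction m) (simp_all add: Poly_append poly_monom mult.commute)
    from this[of "Suc n"] show ?thesis
      using root by (simp add: eval_field_ring cs_def as_def field_ring_simps lessThan_Suc_atMost del: upt_Suc)
  qed
  ultimately have "(algebraic over F) x" using cs(2) by (intro algebraicI)
  then have "finite_dimension F (simple_extension F x)"
    using finite_dimension_simple_extension[OF F(1)] by simp
  then have "finite_dimension base (simple_extension F x)"
    using telescopic_base_dim(1)[OF subfield_base F] by simp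
  moreover have "subring (simple_extension F x) (transport (\<lambda>x::'a. x))"
    using simple_extension_is_subring[OF subfieldE(1)[OF F(1)]] by simp
  moreover have "x \<in> simple_extension F x"
    using simple_extension_mem[OF subfieldE(1)[OF F(1)]] by simp
  ultimately show "alg x"
    unfolding alg_iff_algebraic using finite_dimension_imp_algebraic[OF subfield_base] by blast
qed

lemma alg_generators: "alg \<epsilon>" "alg f"
proof -
  have "alg (ev2 \<epsilon> f T)" for T
    unfolding alg_def
    by (rule exI[of _ "[:- T, 1:]"]) (simp add: ev2_hom)
  from this[of "[:[:0, 1:]:]"] this[of "[:0, 1:]"] show "alg \<epsilon>" "alg f"
    by (simp_all add: ev1_hom)
qed

lemma countable_alg: "countable {x. alg x}"
proof -
  have "{x. alg x} = (\<Union>P\<in>{P. P \<noteq> 0}. {x. ev3 \<epsilon> f x P = 0})"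
    by (auto simp: alg_def)
  moreover have "finite {x. ev3 \<epsilon> f x P = 0}" if "P \<noteq> 0" for P
    unfolding peval_def[of "ev2 \<epsilon> f"] using that
    by (intro poly_roots_finite) (simp add: map_poly_eq_0_iff ev2_hom ev2_eq_0_iff)
  then have "countable (\<Union>P\<in>{P. P \<noteq> 0}. {x. ev3 \<epsilon> f x P = 0})"
    by (intro countable_UN) (auto intro: countable_finite)
  ultimately show ?thesis by simp
qed

lemma infinite_alg: "infinite {x. alg x}"
proof
  assume "finite {x. alg x}"
  moreover have "range (of_rat :: rat \<Rightarrow> 'a) \<subseteq> {x. alg x}"
    using subfield_set_of_rat[OF subfield_alg] by blast
  ultimately have "finite (range (of_rat :: rat \<Rightarrow> 'a))" by (rule rev_finite_subset)
  then show False
    using finite_imageD[of of_rat UNIV] infinite_UNIV_char_0 by (auto simp: inj_on_def)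
qed

end

section \<open>The rigid field\<close>

lemma coeff_bounded:
  fixes g :: "'a::zero \<Rightarrow> nat"
  shows "\<exists>N. \<forall>k. g (coeff p k) < N"
proof (induction p)
  case (pCons a p)
  then obtain N where "\<And>k. g (coeff p k) < N" by blast
  then have "g (coeff (pCons a p) k) < N + Suc (g a)" for k
    by (auto simp: coeff_pCons less_Suc_eq trans_less_add1 split: nat.split)
  then show ?case by blast
qed auto

text \<open>Read \<open>\<Phi> m a\<close> as "\<open>m\<close> clears the denominators of
  \<open>a\<close>". Stability under multiples lets a product serve all coefficients, and the lemma
  is used once per level of nesting.\<close>

lemma coeff_common_multiple:
  fixes \<Phi> :: "int \<Rightarrow> 'a::zero \<Rightarrow> bool"
  assumes ex: "\<And>a. \<exists>m>0. \<Phi> m a" and mult: "\<And>m m' a. \<Phi> m a \<Longrightarrow> \<Phi> (m * m') a"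
  shows "\<exists>m>0. \<forall>k. \<Phi> m (coeff p k)"
proof (induction p)
  case 0
  then show ?case using ex by simp
next
  case (pCons a p)
  then obtain m where m: "m > 0" "\<And>k. \<Phi> m (coeff p k)" by blast
  obtain m' where m': "m' > 0" "\<Phi> m' a" using ex by blast
  have "\<Phi> (m * m') (coeff (pCons a p) k)" for k
    using mult[OF m(2), of m'] mult[OF m'(2), of m] by (auto simp: coeff_pCons mult.commute split: nat.split)
  then show ?case using m(1) m'(1) by (intro exI[of _ "m * m'"]) simp
qed

lemma integer_coefficients:
  fixes P :: "rat poly poly poly"
  obtains m :: int and c where "m > 0" "\<And>i j k. of_int (c i j k) = of_int m * coeff (coeff (coeff P k) j) i"
proof -
  define \<Phi>1 where "\<Phi>1 m a \<longleftrightarrow> of_int m * a \<in> \<int>" for m :: int and a :: rat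
  define \<Phi>2 where "\<Phi>2 m p \<longleftrightarrow> (\<forall>i. \<Phi>1 m (coeff p i))" for m p
  define \<Phi>3 where "\<Phi>3 m p \<longleftrightarrow> (\<forall>i. \<Phi>2 m (coeff p i))" for m p
  have 1: "\<exists>m>0. \<Phi>1 m a" for a
  proof (cases a)
    case (Fract u v)
    then have "of_int v * a = of_int u" by (simp add: of_rat_rat Fract_of_int_quotient)
    then have "\<Phi>1 v a" by (simp add: \<Phi>1_def)
    then show ?thesis using Fract by blast
  qed
  have mult1: "\<Phi>1 m a \<Longrightarrow> \<Phi>1 (m * m') a" for m m' a
    using Ints_mult[of "of_int m * a" "of_int m'"] by (simp add: \<Phi>1_def ac_simps)
  have mult2: "\<Phi>2 m a \<Longrightarrow> \<Phi>2 (m * m') a" for m m' a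
    using mult1 by (simp add: \<Phi>2_def)
  have mult3: "\<Phi>3 m a \<Longrightarrow> \<Phi>3 (m * m') a" for m m' a
    using mult2 by (simp add: \<Phi>3_def)
  have 2: "\<exists>m>0. \<Phi>2 m a" for a
    unfolding \<Phi>2_def using 1 mult1 by (rule coeff_common_multiple)
  have 3: "\<exists>m>0. \<Phi>3 m a" for a
    unfolding \<Phi>3_def using 2 mult2 by (rule coeff_common_multiple)
  have "\<exists>m>0. \<forall>k. \<Phi>3 m (coeff P k)"
    using 3 mult3 by (rule coeff_common_multiple)
  then obtain m where m: "m > 0" "\<And>i j k. of_int m * coeff (coeff (coeff P k) j) i \<in> \<int>"
    by (auto simp: \<Phi>1_def \<Phi>2_def \<Phi>3_def)
  show ?thesis
    by (rule that[of m "\<lambda>i j k. \<lfloor>of_int m * coeff (coeff (coeff P k) j) i\<rfloor>"]) (use m in auto)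
qed

text \<open>The last two assumptions concern the ambient field. The algebraic closure inherits them
  because roots of polynomials with algebraic coefficients are algebraic.\<close>

locale rigid_rcf = generic_pair p M \<epsilon> f
  for p M and \<epsilon> f :: "'a::linordered_field" +
  fixes d :: "nat \<Rightarrow> 'a"
  assumes inj_enum: "inj d" and range_enum: "range d = {x. alg x}"
    and has_sqrt: "\<And>x::'a. 0 \<le> x \<Longrightarrow> \<exists>y. x = y * y"
    and has_odd_root: "\<And>n (a :: nat \<Rightarrow> 'a). odd n \<Longrightarrow> a n \<noteq> 0 \<Longrightarrow> \<exists>x. (\<Sum>i\<le>n. a i * x ^ i) = 0"
begin

sublocale field_embedding d
  using inj_enum subfield_alg by unfold_locales (simp_all add: range_enum)

lemma alg_d: "alg (d x)"
  using range_enum by blast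

lemma obtain_d:
  assumes "alg y"
  obtains x where "d x = y"
  using assms range_enum by (metis (mono_tags, lifting) imageE mem_Collect_eq)

lemma alg_sqrt:
  assumes "alg x" "0 \<le> x"
  shows "\<exists>y. alg y \<and> x = y * y"
proof -
  obtain y where y: "x = y * y" using has_sqrt assms(2) by blast
  have "alg y"
  proof (rule alg_root)
    show "alg (if i = 0 then - x else if i = 2 then 1 else 0)" for i :: nat
      using assms(1) subfield_setD[OF subfield_alg] by auto
    show "(\<Sum>i\<le>2. (if i = 0 then - x else if i = 2 then 1 else 0) * y ^ i) = 0"
      by (simp add: y eval_nat_numeral)
  qed simp
  then show ?thesis using y by blast
qed

lemma square_N:
  assumes "0 \<le> d x"
  obtains y where "x = y \<otimes>\<^bsub>N\<^esub> y"
proof -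
  obtain y where "alg y" "d x = y * y" using alg_sqrt[OF alg_d assms] by blast
  moreover from this(1) obtain y' where "d y' = y" by (rule obtain_d)
  ultimately show ?thesis using that[of y'] by (simp add: d_ops flip: d_eq_iff)
qed

lemma real_closed_N: "real_closed_field N"
  unfolding real_closed_field_def formally_real_def
proof (intro conjI allI impI ballI)
  show "field N" by (rule field_N)
  show "finsum N (\<lambda>i. a i \<otimes>\<^bsub>N\<^esub> a i) {..<n} \<noteq> \<ominus>\<^bsub>N\<^esub> \<one>\<^bsub>N\<^esub>" for n :: nat and a
  proof
    assume "finsum N (\<lambda>i. a i \<otimes>\<^bsub>N\<^esub> a i) {..<n} = \<ominus>\<^bsub>N\<^esub> \<one>\<^bsub>N\<^esub>"
    then have "(\<Sum>i<n. d (a i) * d (a i)) = - 1"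
      by (simp add: d_finsum d_ops d_uminus flip: d_eq_iff)
    moreover have "0 \<le> (\<Sum>i<n. d (a i) * d (a i))" by (intro sum_nonneg) simp
    ultimately show False by simp
  qed
  show "(\<exists>y\<in>carrier N. x = y \<otimes>\<^bsub>N\<^esub> y) \<or> (\<exists>y\<in>carrier N. \<ominus>\<^bsub>N\<^esub> x = y \<otimes>\<^bsub>N\<^esub> y)" for x
  proof (cases "0 \<le> d x")
    case True
    then obtain y where "x = y \<otimes>\<^bsub>N\<^esub> y" by (rule square_N)
    then show ?thesis by auto
  next
    case False
    then have "0 \<le> d (\<ominus>\<^bsub>N\<^esub> x)" by (simp add: d_uminus)
    then obtain y where "\<ominus>\<^bsub>N\<^esub> x = y \<otimes>\<^bsub>N\<^esub> y" by (rule square_N)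
    then show ?thesis by auto
  qed
  fix n :: nat and a
  assume "odd n" "a n \<noteq> \<zero>\<^bsub>N\<^esub>"
  then have nz: "d (a n) \<noteq> 0" by (simp add: d_ops flip: d_eq_iff)
  obtain x where x: "(\<Sum>i\<le>n. d (a i) * x ^ i) = 0"
    using has_odd_root[OF \<open>odd n\<close>, of "\<lambda>i. d (a i)"] nz by blast
  have "alg x" using alg_d nz x by (rule alg_root)
  then obtain x' where "d x' = x" by (rule obtain_d)
  then have "finsum N (\<lambda>i. a i \<otimes>\<^bsub>N\<^esub> x' [^]\<^bsub>N\<^esub> i) {..n} = \<zero>\<^bsub>N\<^esub>"
    using x by (simp add: d_finsum d_ops d_power flip: d_eq_iff)
  then show "\<exists>x\<in>carrier N. finsum N (\<lambda>i. a i \<otimes>\<^bsub>N\<^esub> x [^]\<^bsub>N\<^esub> i) {..n} = \<zero>\<^bsub>N\<^esub>" by auto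
qed

lemma non_archimedean_N: "non_archimedean N"
proof -
  have "alg (inverse \<epsilon>)" using alg_generators subfield_setD[OF subfield_alg] by simp
  then obtain x where x: "d x = inverse \<epsilon>" by (rule obtain_d)
  have "rcf_less N (add_pow N n \<one>\<^bsub>N\<^esub>) x" for n :: nat
  proof -
    have less: "of_nat n < inverse \<epsilon>"
      using eps_infinitesimal[of n] eps_pos by (simp add: field_simps)
    then have "0 \<le> d (x \<ominus>\<^bsub>N\<^esub> add_pow N n \<one>\<^bsub>N\<^esub>)"
      by (simp add: d_minus d_add_pow_nat d_ops x)
    then obtain y where "x \<ominus>\<^bsub>N\<^esub> add_pow N n \<one>\<^bsub>N\<^esub> = y \<otimes>\<^bsub>N\<^esub> y" by (rule square_N)
    moreover have "add_pow N n \<one>\<^bsub>N\<^esub> \<noteq> x"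
      using less by (simp add: d_add_pow_nat d_ops x flip: d_eq_iff)
    ultimately show ?thesis by (auto simp: rcf_less_def rcf_le_def)
  qed
  then show ?thesis by (auto simp: non_archimedean_def)
qed

lemma d_eval_int_poly2:
  "d (eval_int_poly2 N c n x y) = (\<Sum>i<n. \<Sum>j<n. of_int (c i j) * (d x ^ i * d y ^ j))"
  by (simp add: eval_int_poly2_def d_finsum d_add_pow_int d_ops d_power)

lemma alg_indep_N:
  assumes "d x = \<epsilon>" "d y = f"
  shows "alg_indep2 N x y"
  unfolding alg_indep2_def
proof (intro allI impI)
  fix c n i j
  assume eval: "eval_int_poly2 N c n x y = \<zero>\<^bsub>N\<^esub>" and ij: "i < n" "j < n"
  \<comment> \<open>The integer double sum as a nested polynomial, with the powers of
    \<open>f\<close> in the outer variable; this explains the exchange of sums.\<close>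
  define T :: "rat poly poly" where "T = (\<Sum>j<n. monom (\<Sum>i<n. monom (of_int (c i j)) i) j)"
  have "ev2 \<epsilon> f T = (\<Sum>j<n. \<Sum>i<n. of_int (c i j) * (\<epsilon> ^ i * f ^ j))"
    by (simp add: T_def rhom_sum peval_monom ev1_hom sum_distrib_left sum_distrib_right ac_simps)
  also have "\<dots> = d (eval_int_poly2 N c n x y)"
    by (subst sum.swap) (simp add: d_eval_int_poly2 assms)
  finally have "T = 0" using eval by (simp add: d_ops ev2_eq_0_iff)
  then have "coeff (coeff T j) i = 0" by simp
  moreover have "coeff (coeff T j) i = of_int (c i j)"
    using ij by (simp add: T_def coeff_sum sum.delta)
  ultimately show "c i j = 0" by simp
qed

lemma algebraic_N:
  assumes "d x = \<epsilon>" "d y = f"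
  shows "algebraic_over2 N x y z"
proof -
  obtain P where P: "P \<noteq> 0" "ev3 \<epsilon> f (d z) P = 0" using alg_d[of z] by (auto simp: alg_def)
  obtain m :: int and c where c: "m > 0" "\<And>i j k. of_int (c i j k) = of_int m * coeff (coeff (coeff P k) j) i"
    using integer_coefficients[of P] by blast
  obtain N1 where N1: "\<And>k. degree (coeff P k) < N1" using coeff_bounded by blast
  have "\<exists>N2. \<forall>j. degree (coeff T j) < N2" for T :: "rat poly poly"
    by (rule coeff_bounded)
  then obtain b where b: "\<And>(T :: rat poly poly) j. degree (coeff T j) < b T" by metis
  obtain N2 where N2: "\<And>k. b (coeff P k) < N2" using coeff_bounded by blast
  \<comment> \<open>A single bound must exceed the degrees at all three levels, because
    \<open>algebraic_over2\<close> uses one range for all exponents.\<close>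
  define n where "n = Suc (degree P) + N1 + N2"
  have n: "degree P < n" "degree (coeff P k) < n" "degree (coeff (coeff P k) j) < n" for k j
    using N1[of k] N2[of k] b[of "coeff P k" j] by (auto simp: n_def)
  have of_int_c: "of_int (c i j k) = of_int m * (of_rat (coeff (coeff (coeff P k) j) i) :: 'a)" for i j k
    using arg_cong[OF c(2)[of i j k], of "of_rat :: rat \<Rightarrow> 'a"] by (simp add: of_rat_mult)
  have eval: "d (eval_int_poly2 N (\<lambda>i j. c i j k) n x y) = of_int m * ev2 \<epsilon> f (coeff P k)" for k
  proof -
    have "ev2 \<epsilon> f (coeff P k) = (\<Sum>j<n. (\<Sum>i<n. of_rat (coeff (coeff (coeff P k) j) i) * \<epsilon> ^ i) * f ^ j)"
      using n by (simp add: peval_lessThan[where n = n] ev1_hom)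
    then show ?thesis
      by (subst d_eval_int_poly2, subst sum.swap)
        (simp add: assms of_int_c sum_distrib_left sum_distrib_right ac_simps)
  qed
  show ?thesis
    unfolding algebraic_over2_def
  proof (intro exI conjI)
    have "d (eval_int_poly2 N (\<lambda>i j. c i j (degree P)) n x y) \<noteq> 0"
      using P(1) c(1) by (simp add: eval ev2_eq_0_iff)
    then show "eval_int_poly2 N (\<lambda>i j. c i j (degree P)) n x y \<noteq> \<zero>\<^bsub>N\<^esub>"
      using d_ops(4) by auto
    show "degree P < n" by (rule n)
    have "d (finsum N (\<lambda>k. eval_int_poly2 N (\<lambda>i j. c i j k) n x y \<otimes>\<^bsub>N\<^esub> z [^]\<^bsub>N\<^esub> k) {..<n})
        = of_int m * (\<Sum>k<n. ev2 \<epsilon> f (coeff P k) * d z ^ k)"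
      by (simp add: d_finsum d_ops d_power eval sum_distrib_left ac_simps)
    also have "(\<Sum>k<n. ev2 \<epsilon> f (coeff P k) * d z ^ k) = 0"
      using P(2) n(1) by (simp add: peval_lessThan[where n = n] ev2_hom)
    finally show "finsum N (\<lambda>k. eval_int_poly2 N (\<lambda>i j. c i j k) n x y \<otimes>\<^bsub>N\<^esub> z [^]\<^bsub>N\<^esub> k) {..<n} = \<zero>\<^bsub>N\<^esub>"
      by (simp add: d_ops flip: d_eq_iff)
  qed
qed

lemma trdeg_two_N: "trdeg_two N"
proof -
  obtain x y where "d x = \<epsilon>" "d y = f" using alg_generators obtain_d by metis
  then have "alg_indep2 N x y" "\<forall>z. algebraic_over2 N x y z"
    using alg_indep_N algebraic_N by blast+
  then show ?thesis
    by (auto simp: trdeg_two_def)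
qed

lemma rigid_N: "rigid_field N"
  unfolding rigid_field_def
proof (intro ballI)
  fix h x
  assume "h \<in> ring_iso N N"
  then have bij: "bij h" and add: "\<And>x y. h (x \<oplus>\<^bsub>N\<^esub> y) = h x \<oplus>\<^bsub>N\<^esub> h y"
    and mult: "\<And>x y. h (x \<otimes>\<^bsub>N\<^esub> y) = h x \<otimes>\<^bsub>N\<^esub> h y"
    by (auto simp: ring_iso_def ring_hom_def)
  \<comment> \<open>The automorphism of the copy on \<open>nat\<close> is conjugated by
    \<open>d\<close> to act on the algebraic elements; values elsewhere are arbitrary.\<close>
  define \<sigma> where "\<sigma> z = d (h (inv_into UNIV d z))" for z
  have \<sigma>_d: "\<sigma> (d z) = d (h z)" for z
    using inj_enum by (simp add: \<sigma>_def)
  have "field_aut {x. alg x} \<sigma>"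
  proof
    show "subfield_set {x. alg x}" by (rule subfield_alg)
    show "\<exists>b\<in>{x. alg x}. a = b * b" if "a \<in> {x. alg x}" "0 \<le> a" for a
      using alg_sqrt[of a] that by blast
    show "bij_betw \<sigma> {x. alg x} {x. alg x}"
    proof -
      have d: "bij_betw d UNIV {x. alg x}"
        using inj_enum range_enum by (simp add: bij_betw_def)
      have "bij_betw (d \<circ> (h \<circ> inv_into UNIV d)) {x. alg x} {x. alg x}"
        by (rule bij_betw_trans[OF bij_betw_trans[OF bij_betw_inv_into[OF d] bij] d])
      then show ?thesis by (simp add: \<sigma>_def[abs_def] comp_def)
    qed
    fix a b
    assume "a \<in> {x. alg x}" "b \<in> {x. alg x}"
    then have "a \<in> range d" "b \<in> range d" using range_enum by simp_all
    then obtain a' b' where ab: "a = d a'" "b = d b'" by blast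
    show "\<sigma> (a + b) = \<sigma> a + \<sigma> b"
      using \<sigma>_d[of "a' \<oplus>\<^bsub>N\<^esub> b'"] by (simp add: ab \<sigma>_d add d_ops)
    show "\<sigma> (a * b) = \<sigma> a * \<sigma> b"
      using \<sigma>_d[of "a' \<otimes>\<^bsub>N\<^esub> b'"] by (simp add: ab \<sigma>_d mult d_ops)
  qed
  then have "\<sigma> (d x) = d x"
    using alg_generators alg_d by (intro aut_trivial[where K = "{x. alg x}"]) auto
  then show "h x = x" by (simp add: \<sigma>_d d_eq_iff)
qed

end

theorem theorem2p2:
  shows "\<exists>K :: nat ring. real_closed_field K \<and> non_archimedean K \<and> trdeg_two K \<and> rigid_field K"
proof -
  obtain p M and \<epsilon> f :: hyperreal where "generic_pair p M \<epsilon> f"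
    by (rule exists_generic_pair)
  then interpret generic_pair p M \<epsilon> f .
  \<comment> \<open>The closure is countably infinite, so it can be enumerated without repetition,
    which allows \<open>nat\<close> as the carrier type.\<close>
  define d where "d = from_nat_into {x. alg x}"
  have "bij_betw d UNIV {x. alg x}"
    unfolding d_def using countable_alg infinite_alg by (rule bij_betw_from_nat_into)
  then interpret rigid_rcf p M \<epsilon> f d
    using hyperreal_sqrt hyperreal_odd_root
    by unfold_locales (auto simp: bij_betw_def, metis+)
  show ?thesis
    using real_closed_N non_archimedean_N trdeg_two_N rigid_N by blast
qed

end
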